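(* Let $\mathcal{V}$ be a variety of residuated lattices defined, relative to the variety of semilinear cancellative integral residuated lattices, by a set of monoid equations. Then $\mathcal{V}$ is generated, as a variety, by the class of those totally ordered members of $\mathcal{V}$ whose monoid reducts are finitely generated monoids.
   Context: A residuated lattice is an algebra $\langle L,\wedge,\vee,\cdot,\backslash,/,\mathrm{e}\rangle$ such that $\langle L,\cdot,\mathrm{e}\rangle$ is a monoid, $\langle L,\wedge,\vee\rangle$ is a lattice, and for all $a,b,d\in L$: $ab\le d \iff a\le d/b \iff b\le a\backslash d$. It is cancellative if its monoid reduct is a cancellative monoid, integral if it satisfies $x\wedge \mathrm{e}\approx x$, and semilinear if it is (isomorphic to) a subdirect product of totally ordered residuated lattices. The semilinear cancellative integral residuated lattices form a variety. A monoid equation is an equation between terms in the signature $\{\cdot,\mathrm{e}\}$. *)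

theory Defs
  imports "HOL-Algebra.Group"
begin

section \<open>Residuated lattices\<close>

text \<open>Algebras live on a carrier set; the monoid reduct is the one of HOL-Algebra.
  \<open>lres L a d\<close> is $a \backslash d$ and \<open>rres L d b\<close> is $d / b$.\<close>

record 'a rl = "'a monoid" +
  rl_meet :: "'a \<Rightarrow> 'a \<Rightarrow> 'a"  (infixl \<open>\<^bold>\<and>\<index>\<close> 65)
  rl_join :: "'a \<Rightarrow> 'a \<Rightarrow> 'a"  (infixl \<open>\<^bold>\<or>\<index>\<close> 65)
  lres :: "'a \<Rightarrow> 'a \<Rightarrow> 'a"
  rres :: "'a \<Rightarrow> 'a \<Rightarrow> 'a"

definition rl_le :: "'a rl \<Rightarrow> 'a \<Rightarrow> 'a \<Rightarrow> bool"  (infix \<open>\<preceq>\<index>\<close> 50)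
  where "x \<preceq>\<^bsub>L\<^esub> y \<longleftrightarrow> x \<^bold>\<and>\<^bsub>L\<^esub> y = x"

locale residuated_lattice = monoid L for L :: "'a rl" (structure) +
  assumes meet_closed: "\<lbrakk>x \<in> carrier L; y \<in> carrier L\<rbrakk> \<Longrightarrow> x \<^bold>\<and> y \<in> carrier L"
    and join_closed: "\<lbrakk>x \<in> carrier L; y \<in> carrier L\<rbrakk> \<Longrightarrow> x \<^bold>\<or> y \<in> carrier L"
    and lres_closed: "\<lbrakk>x \<in> carrier L; y \<in> carrier L\<rbrakk> \<Longrightarrow> lres L x y \<in> carrier L"
    and rres_closed: "\<lbrakk>x \<in> carrier L; y \<in> carrier L\<rbrakk> \<Longrightarrow> rres L x y \<in> carrier L"
    and meet_comm: "\<lbrakk>x \<in> carrier L; y \<in> carrier L\<rbrakk> \<Longrightarrow> x \<^bold>\<and> y = y \<^bold>\<and> x"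
    and join_comm: "\<lbrakk>x \<in> carrier L; y \<in> carrier L\<rbrakk> \<Longrightarrow> x \<^bold>\<or> y = y \<^bold>\<or> x"
    and meet_assoc: "\<lbrakk>x \<in> carrier L; y \<in> carrier L; z \<in> carrier L\<rbrakk>
          \<Longrightarrow> (x \<^bold>\<and> y) \<^bold>\<and> z = x \<^bold>\<and> (y \<^bold>\<and> z)"
    and join_assoc: "\<lbrakk>x \<in> carrier L; y \<in> carrier L; z \<in> carrier L\<rbrakk>
          \<Longrightarrow> (x \<^bold>\<or> y) \<^bold>\<or> z = x \<^bold>\<or> (y \<^bold>\<or> z)"
    and meet_absorb: "\<lbrakk>x \<in> carrier L; y \<in> carrier L\<rbrakk> \<Longrightarrow> x \<^bold>\<and> (x \<^bold>\<or> y) = x"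
    and join_absorb: "\<lbrakk>x \<in> carrier L; y \<in> carrier L\<rbrakk> \<Longrightarrow> x \<^bold>\<or> (x \<^bold>\<and> y) = x"
    and residuation_right: "\<lbrakk>a \<in> carrier L; b \<in> carrier L; d \<in> carrier L\<rbrakk>
          \<Longrightarrow> a \<otimes> b \<preceq> d \<longleftrightarrow> a \<preceq> rres L d b"
    and residuation_left: "\<lbrakk>a \<in> carrier L; b \<in> carrier L; d \<in> carrier L\<rbrakk>
          \<Longrightarrow> a \<otimes> b \<preceq> d \<longleftrightarrow> b \<preceq> lres L a d"

definition cancellative :: "'a rl \<Rightarrow> bool"
  where "cancellative L \<longleftrightarrow>
    (\<forall>a\<in>carrier L. \<forall>b\<in>carrier L. \<forall>c\<in>carrier L.
       (a \<otimes>\<^bsub>L\<^esub> b = a \<otimes>\<^bsub>L\<^esub> c \<longrightarrow> b = c) \<and> (b \<otimes>\<^bsub>L\<^esub> a = c \<otimes>\<^bsub>L\<^esub> a \<longrightarrow> b = c))"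

definition integral :: "'a rl \<Rightarrow> bool"
  where "integral L \<longleftrightarrow> (\<forall>x\<in>carrier L. x \<^bold>\<and>\<^bsub>L\<^esub> \<one>\<^bsub>L\<^esub> = x)"

definition totally_ordered :: "'a rl \<Rightarrow> bool"
  where "totally_ordered L \<longleftrightarrow> (\<forall>x\<in>carrier L. \<forall>y\<in>carrier L. x \<preceq>\<^bsub>L\<^esub> y \<or> y \<preceq>\<^bsub>L\<^esub> x)"

definition finitely_generated_monoid :: "('a, 'm) monoid_scheme \<Rightarrow> bool"
  where "finitely_generated_monoid M \<longleftrightarrow>
    (\<exists>X. finite X \<and> X \<subseteq> carrier M \<and> (\<forall>H. submonoid H M \<and> X \<subseteq> H \<longrightarrow> H = carrier M))"

section \<open>Homomorphisms, subalgebras, products\<close>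

definition rl_hom :: "'a rl \<Rightarrow> 'b rl \<Rightarrow> ('a \<Rightarrow> 'b) set"
  where "rl_hom A B = {h \<in> hom A B. h \<one>\<^bsub>A\<^esub> = \<one>\<^bsub>B\<^esub> \<and>
    (\<forall>x\<in>carrier A. \<forall>y\<in>carrier A.
       h (x \<^bold>\<and>\<^bsub>A\<^esub> y) = h x \<^bold>\<and>\<^bsub>B\<^esub> h y \<and> h (x \<^bold>\<or>\<^bsub>A\<^esub> y) = h x \<^bold>\<or>\<^bsub>B\<^esub> h y \<and>
       h (lres A x y) = lres B (h x) (h y) \<and> h (rres A x y) = rres B (h x) (h y))}"

definition rl_subuniverse :: "'a set \<Rightarrow> 'a rl \<Rightarrow> bool"
  where "rl_subuniverse S A \<longleftrightarrow> S \<subseteq> carrier A \<and> \<one>\<^bsub>A\<^esub> \<in> S \<and>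
    (\<forall>x\<in>S. \<forall>y\<in>S. x \<otimes>\<^bsub>A\<^esub> y \<in> S \<and> x \<^bold>\<and>\<^bsub>A\<^esub> y \<in> S \<and> x \<^bold>\<or>\<^bsub>A\<^esub> y \<in> S \<and>
       lres A x y \<in> S \<and> rres A x y \<in> S)"

definition rl_product :: "'i set \<Rightarrow> ('i \<Rightarrow> 'b rl) \<Rightarrow> ('i \<Rightarrow> 'b) rl"
  where "rl_product I F =
    \<lparr> carrier = (\<Pi>\<^sub>E i\<in>I. carrier (F i)),
      mult = (\<lambda>x y. \<lambda>i\<in>I. x i \<otimes>\<^bsub>F i\<^esub> y i),
      one = (\<lambda>i\<in>I. \<one>\<^bsub>F i\<^esub>),
      rl_meet = (\<lambda>x y. \<lambda>i\<in>I. x i \<^bold>\<and>\<^bsub>F i\<^esub> y i),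
      rl_join = (\<lambda>x y. \<lambda>i\<in>I. x i \<^bold>\<or>\<^bsub>F i\<^esub> y i),
      lres = (\<lambda>x y. \<lambda>i\<in>I. lres (F i) (x i) (y i)),
      rres = (\<lambda>x y. \<lambda>i\<in>I. rres (F i) (x i) (y i)) \<rparr>"

definition subdirect_product :: "('i \<Rightarrow> 'b) set \<Rightarrow> 'i set \<Rightarrow> ('i \<Rightarrow> 'b rl) \<Rightarrow> bool"
  where "subdirect_product S I F \<longleftrightarrow>
    rl_subuniverse S (rl_product I F) \<and> (\<forall>i\<in>I. (\<lambda>x. x i) ` S = carrier (F i))"

text \<open>The types of the factors and of the index set are no restriction: every factor is a
  homomorphic image of \<open>A\<close>, hence has an isomorphic copy with carrier in the type of \<open>A\<close>,
  and choosing for each pair of distinct elements of \<open>A\<close> one factor that separates them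
  leaves a subdirect representation indexed by pairs.\<close>

definition semilinear :: "'a rl \<Rightarrow> bool"
  where "semilinear A \<longleftrightarrow>
    (\<exists>(I :: ('a \<times> 'a) set) (F :: 'a \<times> 'a \<Rightarrow> 'a rl) S h.
       (\<forall>i\<in>I. residuated_lattice (F i) \<and> totally_ordered (F i)) \<and>
       subdirect_product S I F \<and>
       h \<in> rl_hom A (rl_product I F \<lparr>carrier := S\<rparr>) \<and> bij_betw h (carrier A) S)"

section \<open>Varieties\<close>

text \<open>The variety generated by \<open>K\<close>, in the form HSP(\<open>K\<close>), restricted to algebras with carrier
  in \<open>'a\<close>. The index type is no restriction: if \<open>A\<close> belongs to the variety generated by \<open>K\<close>,
  it is a homomorphic image of the free algebra of that variety over the set \<open>carrier A\<close>, which
  is a subalgebra of a product with one factor for each member of \<open>K\<close> and each assignment of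
  the free generators in it.\<close>

definition generated_variety :: "'k rl set \<Rightarrow> 'a rl set"
  where "generated_variety K =
    {A. \<exists>(I :: ('k rl \<times> ('a \<Rightarrow> 'k)) set) (F :: 'k rl \<times> ('a \<Rightarrow> 'k) \<Rightarrow> 'k rl) S h.
       (\<forall>i\<in>I. F i \<in> K) \<and> rl_subuniverse S (rl_product I F) \<and>
       h \<in> rl_hom (rl_product I F \<lparr>carrier := S\<rparr>) A \<and> h ` S = carrier A}"

datatype monoid_term = MVar nat | MOne | MMult monoid_term monoid_term

primrec eval_term :: "('a, 'm) monoid_scheme \<Rightarrow> (nat \<Rightarrow> 'a) \<Rightarrow> monoid_term \<Rightarrow> 'a"
  where
    "eval_term M v (MVar n) = v n"
  | "eval_term M v MOne = \<one>\<^bsub>M\<^esub>"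
  | "eval_term M v (MMult s t) = eval_term M v s \<otimes>\<^bsub>M\<^esub> eval_term M v t"

definition satisfies :: "('a, 'm) monoid_scheme \<Rightarrow> monoid_term \<times> monoid_term \<Rightarrow> bool"
  where "satisfies M p \<longleftrightarrow>
    (\<forall>v. range v \<subseteq> carrier M \<longrightarrow> eval_term M v (fst p) = eval_term M v (snd p))"

definition semilinear_canc_int :: "'a rl set"
  where "semilinear_canc_int =
    {A. residuated_lattice A \<and> semilinear A \<and> cancellative A \<and> integral A}"

definition monoid_variety :: "(monoid_term \<times> monoid_term) set \<Rightarrow> 'a rl set"
  where "monoid_variety E = {A \<in> semilinear_canc_int. \<forall>p\<in>E. satisfies A p}"

end

theory Submission
  imports Defs "HOL-Library.Countable_Set"
begin

text \<open>By Birkhoff's theorem (\<open>identities_imp_generated_variety\<close>) an algebra lies in the variety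
  generated by a class \<open>K\<close> as soon as it satisfies all identities of \<open>K\<close>. So there are two
  things to show for the class \<open>K\<close> of finitely generated chains of the variety \<open>V\<close>.

  Every identity that fails in some member of \<open>V\<close> fails in \<open>K\<close>. A semilinear algebra is a subdirect
  product of chains, which are quotients of it and so belong to \<open>V\<close>; hence the identity fails in a
  chain \<open>C\<close> of \<open>V\<close>. Only finitely many elements of \<open>C\<close> are involved in this, the values of the
  subterms. The submonoid \<open>M\<close> that they generate is cancellative, integral and totally ordered, and
  it satisfies the monoid identities of \<open>V\<close>. The point is that \<open>M\<close> also has residuals: \<open>a \ d\<close> has
  to be the greatest \<open>b\<close> in \<open>M\<close> with \<open>ab \<preceq> d\<close>, and such a \<open>b\<close> exists because a finitely generated
  integral chain has no infinite ascending sequences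
  (\<open>monoid_span_ascending_chain_condition\<close>). The residuals of \<open>M\<close> may differ from those of \<open>C\<close>,
  but they agree whenever the residual in \<open>C\<close> lies in \<open>M\<close>, as it does for all subterms of the
  identity. So the identity fails in \<open>M\<close> as well
  (\<open>identity_fails_in_finitely_generated_chain\<close>).

  Conversely, the variety generated by \<open>K\<close> is contained in \<open>V\<close>, since \<open>V\<close> is defined by identities.
  This is immediate for everything but semilinearity. Integral chains satisfy the identities called
  \<open>prelinear\<close> below, and an integral residuated lattice that satisfies them is semilinear
  (\<open>prelinear_imp_semilinear\<close>): its maximal normal filters missing a given element are prime, so
  that the corresponding quotients are chains, and these quotients separate points.\<close>

section \<open>Terms, identities and Birkhoff's theorem\<close>

datatype 'v rl_term =
    Var 'v
  | Unit
  | Times "'v rl_term" "'v rl_term"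
  | Meet "'v rl_term" "'v rl_term"
  | Join "'v rl_term" "'v rl_term"
  | LDiv "'v rl_term" "'v rl_term"
  | RDiv "'v rl_term" "'v rl_term"

primrec rl_eval :: "'a rl \<Rightarrow> ('v \<Rightarrow> 'a) \<Rightarrow> 'v rl_term \<Rightarrow> 'a"
  where
    "rl_eval L v (Var x) = v x"
  | "rl_eval L v Unit = \<one>\<^bsub>L\<^esub>"
  | "rl_eval L v (Times s t) = rl_eval L v s \<otimes>\<^bsub>L\<^esub> rl_eval L v t"
  | "rl_eval L v (Meet s t) = rl_eval L v s \<^bold>\<and>\<^bsub>L\<^esub> rl_eval L v t"
  | "rl_eval L v (Join s t) = rl_eval L v s \<^bold>\<or>\<^bsub>L\<^esub> rl_eval L v t"
  | "rl_eval L v (LDiv s t) = lres L (rl_eval L v s) (rl_eval L v t)"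
  | "rl_eval L v (RDiv s t) = rres L (rl_eval L v s) (rl_eval L v t)"

definition models :: "'a rl \<Rightarrow> 'v rl_term \<times> 'v rl_term \<Rightarrow> bool"
  where "models L p \<longleftrightarrow>
    (\<forall>v. range v \<subseteq> carrier L \<longrightarrow> rl_eval L v (fst p) = rl_eval L v (snd p))"

abbreviation closed_algebra :: "'a rl \<Rightarrow> bool"
  where "closed_algebra L \<equiv> rl_subuniverse (carrier L) L"

lemma rl_eval_in_subuniverse:
  assumes "rl_subuniverse S L" "range v \<subseteq> S"
  shows "rl_eval L v t \<in> S"
  using assms by (induction t) (auto simp: rl_subuniverse_def)

lemma rl_eval_hom:
  assumes h: "h \<in> rl_hom A B" and A: "closed_algebra A" and v: "range v \<subseteq> carrier A"
  shows "rl_eval B (h \<circ> v) t = h (rl_eval A v t)"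
proof (induction t)
  case (Var x)
  then show ?case by simp
next
  case Unit
  then show ?case using h by (simp add: rl_hom_def)
qed (use h rl_eval_in_subuniverse[OF A v] in \<open>simp_all add: rl_hom_def hom_def\<close>)

lemma closed_algebra_image:
  assumes h: "h \<in> rl_hom A B" and A: "closed_algebra A" and sur: "h ` carrier A = carrier B"
  shows "closed_algebra B"
proof -
  have one: "\<one>\<^bsub>B\<^esub> \<in> carrier B"
    using h A unfolding sur[symmetric] by (auto simp: rl_hom_def rl_subuniverse_def intro!: image_eqI)
  have "x \<otimes>\<^bsub>B\<^esub> y \<in> carrier B \<and> x \<^bold>\<and>\<^bsub>B\<^esub> y \<in> carrier B \<and> x \<^bold>\<or>\<^bsub>B\<^esub> y \<in> carrier B \<and>
      lres B x y \<in> carrier B \<and> rres B x y \<in> carrier B"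
    if xy: "x \<in> carrier B" "y \<in> carrier B" for x y
  proof -
    obtain a b where ab: "a \<in> carrier A" "b \<in> carrier A" "x = h a" "y = h b"
      using xy unfolding sur[symmetric] by blast
    have "x \<otimes>\<^bsub>B\<^esub> y = h (a \<otimes>\<^bsub>A\<^esub> b)" "x \<^bold>\<and>\<^bsub>B\<^esub> y = h (a \<^bold>\<and>\<^bsub>A\<^esub> b)" "x \<^bold>\<or>\<^bsub>B\<^esub> y = h (a \<^bold>\<or>\<^bsub>A\<^esub> b)"
      "lres B x y = h (lres A a b)" "rres B x y = h (rres A a b)"
      using h ab by (simp_all add: rl_hom_def hom_def)
    then show ?thesis
      using A ab unfolding sur[symmetric] by (simp add: rl_subuniverse_def)
  qed
  with one show ?thesis by (simp add: rl_subuniverse_def)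
qed

lemma models_image:
  assumes h: "h \<in> rl_hom A B" and A: "closed_algebra A" and sur: "h ` carrier A = carrier B"
    and m: "models A p"
  shows "models B p"
  unfolding models_def
proof (intro allI impI)
  fix v :: "'c \<Rightarrow> 'b"
  assume v: "range v \<subseteq> carrier B"
  define u where "u = inv_into (carrier A) h \<circ> v"
  have mem: "v x \<in> h ` carrier A" for x using v sur by auto
  have u: "range u \<subseteq> carrier A" using inv_into_into[OF mem] by (auto simp: u_def)
  have vu: "v = h \<circ> u" using f_inv_into_f[OF mem] by (auto simp: u_def)
  show "rl_eval B v (fst p) = rl_eval B v (snd p)"
    unfolding vu rl_eval_hom[OF h A u] using m u by (simp add: models_def)
qed

lemma models_embedding:
  assumes h: "h \<in> rl_hom A B" and A: "closed_algebra A" and inj: "inj_on h (carrier A)"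
    and m: "models B p"
  shows "models A p"
  unfolding models_def
proof (intro allI impI)
  fix v :: "'c \<Rightarrow> 'a"
  assume v: "range v \<subseteq> carrier A"
  have "range (h \<circ> v) \<subseteq> carrier B" using h v by (auto simp: rl_hom_def hom_def)
  then have "h (rl_eval A v (fst p)) = h (rl_eval A v (snd p))"
    using m by (simp add: models_def flip: rl_eval_hom[OF h A v])
  then show "rl_eval A v (fst p) = rl_eval A v (snd p)"
    using inj rl_eval_in_subuniverse[OF A v] by (simp add: inj_on_eq_iff)
qed

lemma rl_eval_carrier_update: "rl_eval (L\<lparr>carrier := S\<rparr>) v t = rl_eval L v t"
  by (induction t) simp_all

lemma models_subalgebra:
  assumes "S \<subseteq> carrier L" "models L p"
  shows "models (L\<lparr>carrier := S\<rparr>) p"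
  using assms by (force simp: models_def rl_eval_carrier_update)

lemma closed_algebra_sub:
  assumes "rl_subuniverse S L"
  shows "closed_algebra (L\<lparr>carrier := S\<rparr>)"
  using assms by (simp add: rl_subuniverse_def)

lemma rl_eval_product:
  assumes "i \<in> I"
  shows "rl_eval (rl_product I F) v t i = rl_eval (F i) (\<lambda>x. v x i) t"
  using assms by (induction t) (simp_all add: rl_product_def)

lemma closed_algebra_product:
  assumes "\<And>i. i \<in> I \<Longrightarrow> closed_algebra (F i)"
  shows "closed_algebra (rl_product I F)"
  using assms by (auto simp: rl_subuniverse_def rl_product_def PiE_iff)

lemma rl_product_eqI:
  assumes "x \<in> carrier (rl_product I F)" "y \<in> carrier (rl_product I F)" "\<And>i. i \<in> I \<Longrightarrow> x i = y i"
  shows "x = y"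
  using assms by (auto simp: rl_product_def intro: PiE_ext)

lemma models_product:
  assumes F: "\<And>i. i \<in> I \<Longrightarrow> closed_algebra (F i)" and m: "\<And>i. i \<in> I \<Longrightarrow> models (F i) p"
  shows "models (rl_product I F) p"
  unfolding models_def
proof (intro allI impI)
  fix v :: "'c \<Rightarrow> _"
  assume v: "range v \<subseteq> carrier (rl_product I F)"
  note cl = rl_eval_in_subuniverse[OF closed_algebra_product[OF F] v]
  show "rl_eval (rl_product I F) v (fst p) = rl_eval (rl_product I F) v (snd p)"
  proof (rule rl_product_eqI[OF cl cl])
    fix i assume i: "i \<in> I"
    then have "range (\<lambda>x. v x i) \<subseteq> carrier (F i)"
      using v by (auto simp: rl_product_def PiE_mem image_subset_iff)
    then show "rl_eval (rl_product I F) v (fst p) i = rl_eval (rl_product I F) v (snd p) i"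
      using m[OF i] i by (simp add: rl_eval_product models_def)
  qed
qed

text \<open>The variables are elements of the type of \<open>A\<close>. Whether \<open>A\<close> lies in the variety generated by
  \<open>K\<close> depends only on identities of this kind, as the proof of Birkhoff's theorem below shows, and
  a law about given elements of \<open>A\<close> becomes such an identity by reading these elements as their
  own names, that is, by evaluating at \<open>self_assignment A\<close>.\<close>

definition satisfies_identities_of :: "'a rl \<Rightarrow> 'b rl set \<Rightarrow> bool"
  where "satisfies_identities_of A K \<longleftrightarrow> closed_algebra A \<and>
    (\<forall>p :: 'a rl_term \<times> 'a rl_term. (\<forall>B\<in>K. models B p) \<longrightarrow> models A p)"

definition self_assignment :: "'a rl \<Rightarrow> 'a \<Rightarrow> 'a"
  where "self_assignment A x = (if x \<in> carrier A then x else \<one>\<^bsub>A\<^esub>)"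

lemma self_assignment_simp [simp]: "x \<in> carrier A \<Longrightarrow> self_assignment A x = x"
  by (simp add: self_assignment_def)

lemma range_self_assignment: "closed_algebra A \<Longrightarrow> range (self_assignment A) \<subseteq> carrier A"
  by (auto simp: self_assignment_def rl_subuniverse_def)

lemma identity_inherited:
  assumes "satisfies_identities_of A K"
    and "\<And>B v. B \<in> K \<Longrightarrow> range v \<subseteq> carrier B \<Longrightarrow> rl_eval B v s = rl_eval B v t"
  shows "rl_eval A (self_assignment A) s = rl_eval A (self_assignment A) t"
proof -
  have "models A (s, t)"
    using assms by (auto simp: satisfies_identities_of_def models_def)
  then show ?thesis
    using range_self_assignment assms(1) by (auto simp: satisfies_identities_of_def models_def)
qed

lemma satisfies_identities_of_image:
  assumes "h \<in> rl_hom A B" "closed_algebra A" "h ` carrier A = carrier B"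
  shows "satisfies_identities_of B {A}"
  using assms closed_algebra_image models_image by (fastforce simp: satisfies_identities_of_def)

lemma satisfies_identities_of_subproduct:
  fixes A :: "'a rl"
  assumes cl: "\<And>i. i \<in> I \<Longrightarrow> closed_algebra (F i)" and A: "closed_algebra A"
    and S: "S \<subseteq> carrier (rl_product I F)"
    and h: "h \<in> rl_hom A (rl_product I F\<lparr>carrier := S\<rparr>)" "inj_on h (carrier A)"
  shows "satisfies_identities_of A (F ` I)"
  unfolding satisfies_identities_of_def
proof (intro conjI allI impI A)
  fix p :: "'a rl_term \<times> 'a rl_term"
  assume "\<forall>B\<in>F ` I. models B p"
  then have "models (rl_product I F) p" using cl by (intro models_product) auto
  from models_embedding[OF h(1) A h(2) models_subalgebra[OF S this]] show "models A p" .
qed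

lemma generated_variety_satisfies_identities:
  fixes A :: "'a rl" and K :: "'k rl set"
  assumes A: "A \<in> generated_variety K" and K: "\<And>B. B \<in> K \<Longrightarrow> closed_algebra B"
  shows "satisfies_identities_of A K"
proof -
  obtain I :: "('k rl \<times> ('a \<Rightarrow> 'k)) set" and F S h
    where F: "\<forall>i\<in>I. F i \<in> K" and S: "rl_subuniverse S (rl_product I F)"
    and h: "h \<in> rl_hom (rl_product I F\<lparr>carrier := S\<rparr>) A" "h ` S = carrier A"
    using A unfolding generated_variety_def by blast
  note clS = closed_algebra_sub[OF S]
  have hS: "h ` carrier (rl_product I F\<lparr>carrier := S\<rparr>) = carrier A" using h(2) by simp
  have sub: "S \<subseteq> carrier (rl_product I F)" using S by (simp add: rl_subuniverse_def)
  have "models A p" if "\<forall>B\<in>K. models B p" for p :: "'a rl_term \<times> 'a rl_term"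
  proof -
    have "models (rl_product I F) p" by (rule models_product) (use F K that in auto)
    from models_image[OF h(1) clS hS models_subalgebra[OF sub this]] show ?thesis .
  qed
  with closed_algebra_image[OF h(1) clS hS] show ?thesis by (simp add: satisfies_identities_of_def)
qed

text \<open>Birkhoff's theorem. Evaluating all terms over \<open>carrier A\<close> at all assignments in members of
  \<open>K\<close> at once gives a subalgebra of a product, namely the free algebra; sending the tuple of
  values of a term to its value in \<open>A\<close> is well defined because two terms with the same tuple form
  an identity of \<open>K\<close>.\<close>

lemma identities_imp_generated_variety:
  fixes A :: "'a rl" and K :: "'k rl set"
  assumes A: "satisfies_identities_of A K" and K: "\<And>B. B \<in> K \<Longrightarrow> closed_algebra B"
  shows "A \<in> generated_variety K"
proof -
  define I :: "('k rl \<times> ('a \<Rightarrow> 'k)) set" where "I = {(B, v). B \<in> K \<and> range v \<subseteq> carrier B}"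
  define P where "P = rl_product I fst"
  define g :: "'a \<Rightarrow> 'k rl \<times> ('a \<Rightarrow> 'k) \<Rightarrow> 'k" where "g a = (\<lambda>i\<in>I. snd i a)" for a
  define val where "val = rl_eval P g"
  define w where "w = self_assignment A"
  define S where "S = range val"
  define h where "h s = rl_eval A w (SOME t. val t = s)" for s
  have clA: "closed_algebra A" using A by (simp add: satisfies_identities_of_def)
  have w: "range w \<subseteq> carrier A" using range_self_assignment[OF clA] by (simp add: w_def)
  have clP: "closed_algebra P"
    unfolding P_def by (rule closed_algebra_product) (auto simp: I_def K)
  have g: "range g \<subseteq> carrier P"
    by (auto simp: g_def P_def rl_product_def I_def image_subset_iff)
  have well: "rl_eval A w s = rl_eval A w t" if st: "val s = val t" for s t
    unfolding w_def
  proof (rule identity_inherited[OF A])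
    fix B :: "'k rl" and v :: "'a \<Rightarrow> 'k" assume B: "B \<in> K" and v: "range v \<subseteq> carrier B"
    then have i: "(B, v) \<in> I" by (simp add: I_def)
    have "rl_eval B v r = val r (B, v)" for r
      unfolding val_def P_def rl_eval_product[OF i] using i by (simp add: g_def)
    then show "rl_eval B v s = rl_eval B v t" using st by simp
  qed
  have h_val: "h (val t) = rl_eval A w t" for t
    unfolding h_def by (rule well, rule someI[where x = t]) simp
  have "val t \<in> carrier P" for t
    unfolding val_def by (rule rl_eval_in_subuniverse[OF clP g])
  moreover have ops: "\<one>\<^bsub>P\<^esub> = val Unit" "val s \<otimes>\<^bsub>P\<^esub> val t = val (Times s t)"
    "val s \<^bold>\<and>\<^bsub>P\<^esub> val t = val (Meet s t)" "val s \<^bold>\<or>\<^bsub>P\<^esub> val t = val (Join s t)"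
    "lres P (val s) (val t) = val (LDiv s t)" "rres P (val s) (val t) = val (RDiv s t)" for s t
    by (simp_all add: val_def)
  ultimately have S: "rl_subuniverse S P"
    unfolding rl_subuniverse_def S_def by auto
  have hom: "h \<in> rl_hom (P\<lparr>carrier := S\<rparr>) A"
    using rl_eval_in_subuniverse[OF clA w]
    by (auto simp: rl_hom_def hom_def S_def ops h_val)
  have "h ` S = carrier A"
  proof
    show "h ` S \<subseteq> carrier A"
      using rl_eval_in_subuniverse[OF clA w] by (auto simp: S_def h_val)
    have "a = h (val (Var a))" if "a \<in> carrier A" for a
      using that unfolding h_val by (simp add: w_def)
    then show "carrier A \<subseteq> h ` S" by (force simp: S_def)
  qed
  moreover have "\<forall>i\<in>I. fst i \<in> K" by (auto simp: I_def)
  ultimately show ?thesis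
    using S hom unfolding generated_variety_def P_def by blast
qed

section \<open>Laws that pass to the generated variety\<close>

context residuated_lattice
begin

lemma meet_idem: "x \<in> carrier L \<Longrightarrow> x \<^bold>\<and> x = x"
  by (metis join_absorb join_closed meet_absorb meet_closed)

lemma le_refl [simp]: "x \<in> carrier L \<Longrightarrow> x \<preceq> x"
  by (simp add: rl_le_def meet_idem)

lemma le_antisym: "\<lbrakk>x \<preceq> y; y \<preceq> x; x \<in> carrier L; y \<in> carrier L\<rbrakk> \<Longrightarrow> x = y"
  by (metis rl_le_def meet_comm)

lemma le_trans: "\<lbrakk>x \<preceq> y; y \<preceq> z; x \<in> carrier L; y \<in> carrier L; z \<in> carrier L\<rbrakk> \<Longrightarrow> x \<preceq> z"
  unfolding rl_le_def by (metis meet_assoc)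

lemma meet_le1: "\<lbrakk>x \<in> carrier L; y \<in> carrier L\<rbrakk> \<Longrightarrow> x \<^bold>\<and> y \<preceq> x"
  unfolding rl_le_def by (metis meet_assoc meet_comm meet_idem meet_closed)

lemma meet_le2: "\<lbrakk>x \<in> carrier L; y \<in> carrier L\<rbrakk> \<Longrightarrow> x \<^bold>\<and> y \<preceq> y"
  using meet_le1[of y x] by (simp add: meet_comm)

lemma le_meetI:
  "\<lbrakk>z \<preceq> x; z \<preceq> y; x \<in> carrier L; y \<in> carrier L; z \<in> carrier L\<rbrakk> \<Longrightarrow> z \<preceq> x \<^bold>\<and> y"
  unfolding rl_le_def by (metis meet_assoc)

lemma le_iff_join: "\<lbrakk>x \<in> carrier L; y \<in> carrier L\<rbrakk> \<Longrightarrow> x \<preceq> y \<longleftrightarrow> x \<^bold>\<or> y = y"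
  unfolding rl_le_def by (metis join_absorb join_comm meet_absorb meet_comm)

lemma join_ge1: "\<lbrakk>x \<in> carrier L; y \<in> carrier L\<rbrakk> \<Longrightarrow> x \<preceq> x \<^bold>\<or> y"
  by (simp add: rl_le_def meet_absorb)

lemma join_ge2: "\<lbrakk>x \<in> carrier L; y \<in> carrier L\<rbrakk> \<Longrightarrow> y \<preceq> x \<^bold>\<or> y"
  using join_ge1[of y x] by (simp add: join_comm)

lemma join_leI:
  "\<lbrakk>x \<preceq> z; y \<preceq> z; x \<in> carrier L; y \<in> carrier L; z \<in> carrier L\<rbrakk> \<Longrightarrow> x \<^bold>\<or> y \<preceq> z"
  by (metis join_assoc join_closed le_iff_join)

lemmas closed_rules [simp] = meet_closed join_closed lres_closed rres_closed

lemma closed_algebra: "closed_algebra L"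
  by (simp add: rl_subuniverse_def)

lemma lres_le: "\<lbrakk>a \<in> carrier L; d \<in> carrier L\<rbrakk> \<Longrightarrow> a \<otimes> lres L a d \<preceq> d"
  by (simp add: residuation_left)

lemma rres_le: "\<lbrakk>b \<in> carrier L; d \<in> carrier L\<rbrakk> \<Longrightarrow> rres L d b \<otimes> b \<preceq> d"
  by (simp add: residuation_right)

lemma mult_left_mono:
  assumes "x \<preceq> y" "x \<in> carrier L" "y \<in> carrier L" "u \<in> carrier L"
  shows "u \<otimes> x \<preceq> u \<otimes> y"
proof -
  have "y \<preceq> lres L u (u \<otimes> y)" using assms by (simp flip: residuation_left)
  then have "x \<preceq> lres L u (u \<otimes> y)" using assms le_trans[of x y] by simp
  then show ?thesis using assms by (simp add: residuation_left)
qed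

lemma mult_right_mono:
  assumes "x \<preceq> y" "x \<in> carrier L" "y \<in> carrier L" "u \<in> carrier L"
  shows "x \<otimes> u \<preceq> y \<otimes> u"
proof -
  have "y \<preceq> rres L (y \<otimes> u) u" using assms by (simp flip: residuation_right)
  then have "x \<preceq> rres L (y \<otimes> u) u" using assms le_trans[of x y] by simp
  then show ?thesis using assms by (simp add: residuation_right)
qed

end

text \<open>Being a residuated lattice is equational: given monotonicity of multiplication, residuation
  says exactly that \<open>x \<preceq> (xy \<or> z) / y\<close> and \<open>(z / y) y \<preceq> z\<close>, and dually.\<close>

lemma residuated_latticeI_equational:
  fixes L :: "'a rl" (structure)
  assumes cl: "closed_algebra L"
    and mon: "\<And>x y z. \<lbrakk>x \<in> carrier L; y \<in> carrier L; z \<in> carrier L\<rbrakk> \<Longrightarrow> (x \<otimes> y) \<otimes> z = x \<otimes> (y \<otimes> z)"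
      "\<And>x. x \<in> carrier L \<Longrightarrow> \<one> \<otimes> x = x" "\<And>x. x \<in> carrier L \<Longrightarrow> x \<otimes> \<one> = x"
    and lat: "\<And>x y. \<lbrakk>x \<in> carrier L; y \<in> carrier L\<rbrakk> \<Longrightarrow> x \<^bold>\<and> y = y \<^bold>\<and> x"
      "\<And>x y. \<lbrakk>x \<in> carrier L; y \<in> carrier L\<rbrakk> \<Longrightarrow> x \<^bold>\<or> y = y \<^bold>\<or> x"
      "\<And>x y z. \<lbrakk>x \<in> carrier L; y \<in> carrier L; z \<in> carrier L\<rbrakk> \<Longrightarrow> (x \<^bold>\<and> y) \<^bold>\<and> z = x \<^bold>\<and> (y \<^bold>\<and> z)"
      "\<And>x y z. \<lbrakk>x \<in> carrier L; y \<in> carrier L; z \<in> carrier L\<rbrakk> \<Longrightarrow> (x \<^bold>\<or> y) \<^bold>\<or> z = x \<^bold>\<or> (y \<^bold>\<or> z)"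
      "\<And>x y. \<lbrakk>x \<in> carrier L; y \<in> carrier L\<rbrakk> \<Longrightarrow> x \<^bold>\<and> (x \<^bold>\<or> y) = x"
      "\<And>x y. \<lbrakk>x \<in> carrier L; y \<in> carrier L\<rbrakk> \<Longrightarrow> x \<^bold>\<or> (x \<^bold>\<and> y) = x"
    and mono: "\<And>x y z. \<lbrakk>x \<in> carrier L; y \<in> carrier L; z \<in> carrier L\<rbrakk> \<Longrightarrow> (x \<^bold>\<and> y) \<otimes> z \<preceq> y \<otimes> z"
      "\<And>x y z. \<lbrakk>x \<in> carrier L; y \<in> carrier L; z \<in> carrier L\<rbrakk> \<Longrightarrow> z \<otimes> (x \<^bold>\<and> y) \<preceq> z \<otimes> y"
    and res: "\<And>x y z. \<lbrakk>x \<in> carrier L; y \<in> carrier L; z \<in> carrier L\<rbrakk> \<Longrightarrow> x \<preceq> rres L (x \<otimes> y \<^bold>\<or> z) y"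
      "\<And>y z. \<lbrakk>y \<in> carrier L; z \<in> carrier L\<rbrakk> \<Longrightarrow> rres L z y \<otimes> y \<preceq> z"
      "\<And>x y z. \<lbrakk>x \<in> carrier L; y \<in> carrier L; z \<in> carrier L\<rbrakk> \<Longrightarrow> y \<preceq> lres L x (x \<otimes> y \<^bold>\<or> z)"
      "\<And>x z. \<lbrakk>x \<in> carrier L; z \<in> carrier L\<rbrakk> \<Longrightarrow> x \<otimes> lres L x z \<preceq> z"
  shows "residuated_lattice L"
proof -
  have [simp]: "\<one> \<in> carrier L"
    and [simp]: "\<And>x y. \<lbrakk>x \<in> carrier L; y \<in> carrier L\<rbrakk> \<Longrightarrow> x \<otimes> y \<in> carrier L"
    "\<And>x y. \<lbrakk>x \<in> carrier L; y \<in> carrier L\<rbrakk> \<Longrightarrow> x \<^bold>\<and> y \<in> carrier L"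
    "\<And>x y. \<lbrakk>x \<in> carrier L; y \<in> carrier L\<rbrakk> \<Longrightarrow> x \<^bold>\<or> y \<in> carrier L"
    "\<And>x y. \<lbrakk>x \<in> carrier L; y \<in> carrier L\<rbrakk> \<Longrightarrow> lres L x y \<in> carrier L"
    "\<And>x y. \<lbrakk>x \<in> carrier L; y \<in> carrier L\<rbrakk> \<Longrightarrow> rres L x y \<in> carrier L"
    using cl by (auto simp: rl_subuniverse_def)
  have trans: "x \<preceq> z" if "x \<preceq> y" "y \<preceq> z" "x \<in> carrier L" "y \<in> carrier L" "z \<in> carrier L" for x y z
    using that lat(3) unfolding rl_le_def by metis
  have join: "x \<^bold>\<or> y = y" if "x \<preceq> y" "x \<in> carrier L" "y \<in> carrier L" for x y
    using that lat(1,2,6) unfolding rl_le_def by metis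
  have r: "a \<otimes> b \<preceq> d \<longleftrightarrow> a \<preceq> rres L d b" (is "?l \<longleftrightarrow> ?r")
    if abd: "a \<in> carrier L" "b \<in> carrier L" "d \<in> carrier L" for a b d
  proof
    assume ?l
    then show ?r using res(1)[of a b d] join[of "a \<otimes> b" d] abd by simp
  next
    assume ?r
    then have "a \<otimes> b \<preceq> rres L d b \<otimes> b"
      using mono(1)[of a "rres L d b" b] abd by (simp add: rl_le_def)
    then show ?l using trans[OF _ res(2)] abd by simp
  qed
  have l: "a \<otimes> b \<preceq> d \<longleftrightarrow> b \<preceq> lres L a d" (is "?l \<longleftrightarrow> ?r")
    if abd: "a \<in> carrier L" "b \<in> carrier L" "d \<in> carrier L" for a b d
  proof
    assume ?l
    then show ?r using res(3)[of a b d] join[of "a \<otimes> b" d] abd by simp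
  next
    assume ?r
    then have "a \<otimes> b \<preceq> a \<otimes> lres L a d"
      using mono(2)[of b "lres L a d" a] abd by (simp add: rl_le_def)
    then show ?l using trans[OF _ res(4)] abd by simp
  qed
  show ?thesis
    by unfold_locales (use mon lat r l in simp_all)
qed

text \<open>In a residuated lattice cancellativity amounts to the identities \<open>a \ (ab) = b\<close> and
  \<open>(ba) / a = b\<close>, and so is equational as well.\<close>

lemma (in residuated_lattice) cancellative_residuals:
  assumes c: "cancellative L" and ab: "a \<in> carrier L" "b \<in> carrier L"
  shows "lres L a (a \<otimes> b) = b" "rres L (b \<otimes> a) a = b"
proof -
  let ?l = "lres L a (a \<otimes> b)" and ?r = "rres L (b \<otimes> a) a"
  have cl: "?l \<in> carrier L" "?r \<in> carrier L" using ab by simp_all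
  have "b \<preceq> ?l" "b \<preceq> ?r"
    using ab by (simp_all flip: residuation_left residuation_right)
  then have "a \<otimes> b \<preceq> a \<otimes> ?l" "b \<otimes> a \<preceq> ?r \<otimes> a"
    using ab by (simp_all add: mult_left_mono mult_right_mono)
  then have "a \<otimes> ?l = a \<otimes> b" "?r \<otimes> a = b \<otimes> a"
    using ab by (simp_all add: le_antisym lres_le rres_le)
  then show "?l = b" "?r = b"
    using c ab cl unfolding cancellative_def by blast+
qed

context
  fixes A :: "'a rl" and K :: "'b rl set"
  assumes A: "satisfies_identities_of A K"
    and K: "\<And>B. B \<in> K \<Longrightarrow> residuated_lattice B"
begin

lemma closed_A: "closed_algebra A"
  using A by (simp add: satisfies_identities_of_def)

lemma residuated_lattice_inherited: "residuated_lattice A"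
proof (rule residuated_latticeI_equational)
  show "closed_algebra A" by (rule closed_A)
  have [simp]: "\<one>\<^bsub>A\<^esub> \<in> carrier A"
    using closed_A by (auto simp: rl_subuniverse_def)
  note tr = identity_inherited[OF A]
  have K': "monoid B" if "B \<in> K" for B
    using K[OF that] by (simp add: residuated_lattice_def)
  note mclosed = monoid.m_closed[OF K'] and oclosed = monoid.one_closed[OF K']
  note closed = residuated_lattice.closed_rules[OF K] mclosed oclosed
  fix x y z
  assume [simp]: "x \<in> carrier A"
  show "\<one>\<^bsub>A\<^esub> \<otimes>\<^bsub>A\<^esub> x = x"
    using tr[of "Times Unit (Var x)" "Var x"] by (simp add: image_subset_iff monoid.l_one[OF K'])
  show "x \<otimes>\<^bsub>A\<^esub> \<one>\<^bsub>A\<^esub> = x"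
    using tr[of "Times (Var x) Unit" "Var x"] by (simp add: image_subset_iff monoid.r_one[OF K'])
  assume [simp]: "y \<in> carrier A"
  show "x \<^bold>\<and>\<^bsub>A\<^esub> y = y \<^bold>\<and>\<^bsub>A\<^esub> x"
    using tr[of "Meet (Var x) (Var y)" "Meet (Var y) (Var x)"]
    by (simp add: image_subset_iff residuated_lattice.meet_comm[OF K])
  show "x \<^bold>\<or>\<^bsub>A\<^esub> y = y \<^bold>\<or>\<^bsub>A\<^esub> x"
    using tr[of "Join (Var x) (Var y)" "Join (Var y) (Var x)"]
    by (simp add: image_subset_iff residuated_lattice.join_comm[OF K])
  show "x \<^bold>\<and>\<^bsub>A\<^esub> (x \<^bold>\<or>\<^bsub>A\<^esub> y) = x"
    using tr[of "Meet (Var x) (Join (Var x) (Var y))" "Var x"]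
    by (simp add: image_subset_iff residuated_lattice.meet_absorb[OF K])
  show "x \<^bold>\<or>\<^bsub>A\<^esub> (x \<^bold>\<and>\<^bsub>A\<^esub> y) = x"
    using tr[of "Join (Var x) (Meet (Var x) (Var y))" "Var x"]
    by (simp add: image_subset_iff residuated_lattice.join_absorb[OF K])
  show "rres A y x \<otimes>\<^bsub>A\<^esub> x \<preceq>\<^bsub>A\<^esub> y"
    using tr[of "Meet (Times (RDiv (Var y) (Var x)) (Var x)) (Var y)" "Times (RDiv (Var y) (Var x)) (Var x)"]
      residuated_lattice.rres_le[OF K] by (simp add: image_subset_iff rl_le_def)
  show "x \<otimes>\<^bsub>A\<^esub> lres A x y \<preceq>\<^bsub>A\<^esub> y"
    using tr[of "Meet (Times (Var x) (LDiv (Var x) (Var y))) (Var y)" "Times (Var x) (LDiv (Var x) (Var y))"]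
      residuated_lattice.lres_le[OF K] by (simp add: image_subset_iff rl_le_def)
  assume [simp]: "z \<in> carrier A"
  show "(x \<otimes>\<^bsub>A\<^esub> y) \<otimes>\<^bsub>A\<^esub> z = x \<otimes>\<^bsub>A\<^esub> (y \<otimes>\<^bsub>A\<^esub> z)"
    using tr[of "Times (Times (Var x) (Var y)) (Var z)" "Times (Var x) (Times (Var y) (Var z))"]
    by (simp add: image_subset_iff monoid.m_assoc[OF K'])
  show "(x \<^bold>\<and>\<^bsub>A\<^esub> y) \<^bold>\<and>\<^bsub>A\<^esub> z = x \<^bold>\<and>\<^bsub>A\<^esub> (y \<^bold>\<and>\<^bsub>A\<^esub> z)"
    using tr[of "Meet (Meet (Var x) (Var y)) (Var z)" "Meet (Var x) (Meet (Var y) (Var z))"]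
    by (simp add: image_subset_iff residuated_lattice.meet_assoc[OF K])
  show "(x \<^bold>\<or>\<^bsub>A\<^esub> y) \<^bold>\<or>\<^bsub>A\<^esub> z = x \<^bold>\<or>\<^bsub>A\<^esub> (y \<^bold>\<or>\<^bsub>A\<^esub> z)"
    using tr[of "Join (Join (Var x) (Var y)) (Var z)" "Join (Var x) (Join (Var y) (Var z))"]
    by (simp add: image_subset_iff residuated_lattice.join_assoc[OF K])
  show "(x \<^bold>\<and>\<^bsub>A\<^esub> y) \<otimes>\<^bsub>A\<^esub> z \<preceq>\<^bsub>A\<^esub> y \<otimes>\<^bsub>A\<^esub> z"
  proof -
    have "(b \<^bold>\<and>\<^bsub>B\<^esub> c) \<otimes>\<^bsub>B\<^esub> d \<preceq>\<^bsub>B\<^esub> c \<otimes>\<^bsub>B\<^esub> d"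
      if "B \<in> K" "b \<in> carrier B" "c \<in> carrier B" "d \<in> carrier B" for B b c d
      using that residuated_lattice.mult_right_mono[OF K, of B "b \<^bold>\<and>\<^bsub>B\<^esub> c" c d]
        residuated_lattice.meet_le2[OF K] closed by simp
    then show ?thesis
      using tr[of "Meet (Times (Meet (Var x) (Var y)) (Var z)) (Times (Var y) (Var z))"
          "Times (Meet (Var x) (Var y)) (Var z)"]
      by (simp add: image_subset_iff rl_le_def)
  qed
  show "z \<otimes>\<^bsub>A\<^esub> (x \<^bold>\<and>\<^bsub>A\<^esub> y) \<preceq>\<^bsub>A\<^esub> z \<otimes>\<^bsub>A\<^esub> y"
  proof -
    have "d \<otimes>\<^bsub>B\<^esub> (b \<^bold>\<and>\<^bsub>B\<^esub> c) \<preceq>\<^bsub>B\<^esub> d \<otimes>\<^bsub>B\<^esub> c"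
      if "B \<in> K" "b \<in> carrier B" "c \<in> carrier B" "d \<in> carrier B" for B b c d
      using that residuated_lattice.mult_left_mono[OF K, of B "b \<^bold>\<and>\<^bsub>B\<^esub> c" c d]
        residuated_lattice.meet_le2[OF K] closed by simp
    then show ?thesis
      using tr[of "Meet (Times (Var z) (Meet (Var x) (Var y))) (Times (Var z) (Var y))"
          "Times (Var z) (Meet (Var x) (Var y))"]
      by (simp add: image_subset_iff rl_le_def)
  qed
  show "x \<preceq>\<^bsub>A\<^esub> rres A (x \<otimes>\<^bsub>A\<^esub> y \<^bold>\<or>\<^bsub>A\<^esub> z) y"
  proof -
    have "b \<preceq>\<^bsub>B\<^esub> rres B (b \<otimes>\<^bsub>B\<^esub> c \<^bold>\<or>\<^bsub>B\<^esub> d) c"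
      if "B \<in> K" "b \<in> carrier B" "c \<in> carrier B" "d \<in> carrier B" for B b c d
      using that residuated_lattice.residuation_right[OF K, of B b c "b \<otimes>\<^bsub>B\<^esub> c \<^bold>\<or>\<^bsub>B\<^esub> d"]
        residuated_lattice.join_ge1[OF K] closed by simp
    then show ?thesis
      using tr[of "Meet (Var x) (RDiv (Join (Times (Var x) (Var y)) (Var z)) (Var y))" "Var x"]
      by (simp add: image_subset_iff rl_le_def)
  qed
  show "y \<preceq>\<^bsub>A\<^esub> lres A x (x \<otimes>\<^bsub>A\<^esub> y \<^bold>\<or>\<^bsub>A\<^esub> z)"
  proof -
    have "c \<preceq>\<^bsub>B\<^esub> lres B b (b \<otimes>\<^bsub>B\<^esub> c \<^bold>\<or>\<^bsub>B\<^esub> d)"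
      if "B \<in> K" "b \<in> carrier B" "c \<in> carrier B" "d \<in> carrier B" for B b c d
      using that residuated_lattice.residuation_left[OF K, of B b c "b \<otimes>\<^bsub>B\<^esub> c \<^bold>\<or>\<^bsub>B\<^esub> d"]
        residuated_lattice.join_ge1[OF K] closed by simp
    then show ?thesis
      using tr[of "Meet (Var y) (LDiv (Var x) (Join (Times (Var x) (Var y)) (Var z)))" "Var y"]
      by (simp add: image_subset_iff rl_le_def)
  qed
qed

lemma integral_inherited:
  assumes "\<And>B. B \<in> K \<Longrightarrow> integral B"
  shows "integral A"
  unfolding integral_def
proof
  fix x assume "x \<in> carrier A"
  then show "x \<^bold>\<and>\<^bsub>A\<^esub> \<one>\<^bsub>A\<^esub> = x"
    using identity_inherited[OF A, of "Meet (Var x) Unit" "Var x"] assms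
    by (simp add: image_subset_iff integral_def)
qed

lemma cancellative_inherited:
  assumes "\<And>B. B \<in> K \<Longrightarrow> cancellative B"
  shows "cancellative A"
proof -
  have id: "lres A a (a \<otimes>\<^bsub>A\<^esub> b) = b" "rres A (b \<otimes>\<^bsub>A\<^esub> a) a = b"
    if "a \<in> carrier A" "b \<in> carrier A" for a b
    using that identity_inherited[OF A, of "LDiv (Var a) (Times (Var a) (Var b))" "Var b"]
      identity_inherited[OF A, of "RDiv (Times (Var b) (Var a)) (Var a)" "Var b"]
      residuated_lattice.cancellative_residuals[OF K assms] by (simp_all add: image_subset_iff)
  show ?thesis
    unfolding cancellative_def using id by metis
qed

end

primrec of_monoid_term :: "(nat \<Rightarrow> 'v) \<Rightarrow> monoid_term \<Rightarrow> 'v rl_term"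
  where
    "of_monoid_term v (MVar n) = Var (v n)"
  | "of_monoid_term v MOne = Unit"
  | "of_monoid_term v (MMult s t) = Times (of_monoid_term v s) (of_monoid_term v t)"

lemma rl_eval_of_monoid_term: "rl_eval L u (of_monoid_term v t) = eval_term L (u \<circ> v) t"
  by (induction t) simp_all

lemma satisfies_inherited:
  assumes A: "satisfies_identities_of A K" and K: "\<And>B. B \<in> K \<Longrightarrow> satisfies B p"
  shows "satisfies A p"
  unfolding satisfies_def
proof (intro allI impI)
  fix v :: "nat \<Rightarrow> _" assume v: "range v \<subseteq> carrier A"
  have "self_assignment A \<circ> v = v"
    using v by (auto simp: image_subset_iff)
  moreover have "rl_eval A (self_assignment A) (of_monoid_term v (fst p)) =
      rl_eval A (self_assignment A) (of_monoid_term v (snd p))"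
    using K by (intro identity_inherited[OF A])
      (auto simp: rl_eval_of_monoid_term satisfies_def image_subset_iff)
  ultimately show "eval_term A v (fst p) = eval_term A v (snd p)"
    by (simp add: rl_eval_of_monoid_term)
qed

section \<open>Images of algebras\<close>

text \<open>The image of \<open>A\<close> under a map whose kernel is a congruence: with a choice of representatives
  for \<open>h\<close> this is a quotient of \<open>A\<close> living in the type of \<open>A\<close>, with an injection for \<open>h\<close> it is
  a copy of \<open>A\<close> in another type.\<close>

definition rl_image :: "('a \<Rightarrow> 'b) \<Rightarrow> 'a rl \<Rightarrow> 'b rl"
  where "rl_image h A = (let r = inv_into (carrier A) h in
    \<lparr> carrier = h ` carrier A,
      mult = (\<lambda>x y. h (r x \<otimes>\<^bsub>A\<^esub> r y)),
      one = h \<one>\<^bsub>A\<^esub>,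
      rl_meet = (\<lambda>x y. h (r x \<^bold>\<and>\<^bsub>A\<^esub> r y)),
      rl_join = (\<lambda>x y. h (r x \<^bold>\<or>\<^bsub>A\<^esub> r y)),
      lres = (\<lambda>x y. h (lres A (r x) (r y))),
      rres = (\<lambda>x y. h (rres A (r x) (r y))) \<rparr>)"

lemma carrier_rl_image [simp]: "carrier (rl_image h A) = h ` carrier A"
  by (simp add: rl_image_def Let_def)

lemma rl_image_hom:
  assumes compat: "\<And>x x' y y'. \<lbrakk>x \<in> carrier A; x' \<in> carrier A; y \<in> carrier A; y' \<in> carrier A;
      h x = h x'; h y = h y'\<rbrakk> \<Longrightarrow>
      h (x \<otimes>\<^bsub>A\<^esub> y) = h (x' \<otimes>\<^bsub>A\<^esub> y') \<and> h (x \<^bold>\<and>\<^bsub>A\<^esub> y) = h (x' \<^bold>\<and>\<^bsub>A\<^esub> y') \<and>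
      h (x \<^bold>\<or>\<^bsub>A\<^esub> y) = h (x' \<^bold>\<or>\<^bsub>A\<^esub> y') \<and> h (lres A x y) = h (lres A x' y') \<and>
      h (rres A x y) = h (rres A x' y')"
  shows "h \<in> rl_hom A (rl_image h A)"
proof -
  define r where "r = inv_into (carrier A) h"
  have r: "r (h x) \<in> carrier A" "h x = h (r (h x))" if "x \<in> carrier A" for x
    using that by (simp_all add: r_def inv_into_into f_inv_into_f)
  have "rl_image h A = \<lparr> carrier = h ` carrier A,
      mult = (\<lambda>x y. h (r x \<otimes>\<^bsub>A\<^esub> r y)),
      one = h \<one>\<^bsub>A\<^esub>,
      rl_meet = (\<lambda>x y. h (r x \<^bold>\<and>\<^bsub>A\<^esub> r y)),
      rl_join = (\<lambda>x y. h (r x \<^bold>\<or>\<^bsub>A\<^esub> r y)),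
      lres = (\<lambda>x y. h (lres A (r x) (r y))),
      rres = (\<lambda>x y. h (rres A (r x) (r y))) \<rparr>"
    by (simp add: rl_image_def r_def Let_def)
  moreover have "h (x \<otimes>\<^bsub>A\<^esub> y) = h (r (h x) \<otimes>\<^bsub>A\<^esub> r (h y)) \<and>
      h (x \<^bold>\<and>\<^bsub>A\<^esub> y) = h (r (h x) \<^bold>\<and>\<^bsub>A\<^esub> r (h y)) \<and>
      h (x \<^bold>\<or>\<^bsub>A\<^esub> y) = h (r (h x) \<^bold>\<or>\<^bsub>A\<^esub> r (h y)) \<and>
      h (lres A x y) = h (lres A (r (h x)) (r (h y))) \<and>
      h (rres A x y) = h (rres A (r (h x)) (r (h y)))"
    if "x \<in> carrier A" "y \<in> carrier A" for x y
    using that r by (intro compat) auto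
  ultimately show ?thesis
    by (simp add: rl_hom_def hom_def)
qed

lemma totally_ordered_image:
  assumes h: "h \<in> rl_hom A B" and sur: "h ` carrier A = carrier B"
    and tot: "\<And>x y. \<lbrakk>x \<in> carrier A; y \<in> carrier A\<rbrakk> \<Longrightarrow> h (x \<^bold>\<and>\<^bsub>A\<^esub> y) = h x \<or> h (y \<^bold>\<and>\<^bsub>A\<^esub> x) = h y"
  shows "totally_ordered B"
  unfolding totally_ordered_def
proof (intro ballI)
  fix u v assume "u \<in> carrier B" "v \<in> carrier B"
  then obtain x y where "x \<in> carrier A" "y \<in> carrier A" "u = h x" "v = h y"
    unfolding sur[symmetric] by blast
  then show "u \<preceq>\<^bsub>B\<^esub> v \<or> v \<preceq>\<^bsub>B\<^esub> u"
    using h tot[of x y] by (simp add: rl_le_def rl_hom_def)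
qed

text \<open>The shape of a subdirect representation that \<open>semilinear\<close> asks for is no restriction:
  it is enough to separate any two elements by a homomorphism onto a chain.\<close>

lemma semilinearI:
  fixes A :: "'a rl"
  assumes A: "closed_algebra A"
    and sep: "\<And>a b. \<lbrakk>a \<in> carrier A; b \<in> carrier A; a \<noteq> b\<rbrakk> \<Longrightarrow>
      \<exists>(B :: 'a rl) h. residuated_lattice B \<and> totally_ordered B \<and> h \<in> rl_hom A B \<and>
        h ` carrier A = carrier B \<and> h a \<noteq> h b"
  shows "semilinear A"
proof -
  define I where "I = {(a, b). a \<in> carrier A \<and> b \<in> carrier A \<and> a \<noteq> b}"
  have "\<exists>(B :: 'a rl) h. residuated_lattice B \<and> totally_ordered B \<and> h \<in> rl_hom A B \<and>
        h ` carrier A = carrier B \<and> h (fst i) \<noteq> h (snd i)" if "i \<in> I" for i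
    using that sep by (auto simp: I_def)
  then obtain F :: "'a \<times> 'a \<Rightarrow> 'a rl" and H where F:
    "\<And>i. i \<in> I \<Longrightarrow> residuated_lattice (F i) \<and> totally_ordered (F i) \<and> H i \<in> rl_hom A (F i) \<and>
        H i ` carrier A = carrier (F i) \<and> H i (fst i) \<noteq> H i (snd i)"
    by metis
  define g where "g x = (\<lambda>i\<in>I. H i x)" for x
  define P where "P = rl_product I F"
  have clP: "closed_algebra P"
    unfolding P_def
    by (intro closed_algebra_product residuated_lattice.closed_algebra) (use F in auto)
  have hom: "g \<in> rl_hom A P"
    using F A
    by (auto simp: rl_hom_def hom_def g_def P_def rl_product_def rl_subuniverse_def fun_eq_iff
        Pi_iff)
  have S: "rl_subuniverse (g ` carrier A) P"
  proof -
    have "\<one>\<^bsub>P\<^esub> = g \<one>\<^bsub>A\<^esub>" using hom by (simp add: rl_hom_def)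
    moreover have "g x \<otimes>\<^bsub>P\<^esub> g y = g (x \<otimes>\<^bsub>A\<^esub> y) \<and> g x \<^bold>\<and>\<^bsub>P\<^esub> g y = g (x \<^bold>\<and>\<^bsub>A\<^esub> y) \<and>
        g x \<^bold>\<or>\<^bsub>P\<^esub> g y = g (x \<^bold>\<or>\<^bsub>A\<^esub> y) \<and> lres P (g x) (g y) = g (lres A x y) \<and>
        rres P (g x) (g y) = g (rres A x y)"
      if "x \<in> carrier A" "y \<in> carrier A" for x y
      using hom that by (simp add: rl_hom_def hom_def)
    moreover have "g ` carrier A \<subseteq> carrier P"
      using hom by (auto simp: rl_hom_def hom_def)
    ultimately show ?thesis
      using A by (auto simp: rl_subuniverse_def)
  qed
  have "(\<lambda>x. x i) ` g ` carrier A = carrier (F i)" if "i \<in> I" for i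
    using F[OF that] that by (auto simp: g_def image_image)
  then have "subdirect_product (g ` carrier A) I F"
    using S by (simp add: subdirect_product_def P_def)
  moreover have "g \<in> rl_hom A (P\<lparr>carrier := g ` carrier A\<rparr>)"
    using hom by (auto simp: rl_hom_def hom_def)
  moreover have "inj_on g (carrier A)"
  proof (rule inj_onI, rule ccontr)
    fix a b assume ab: "a \<in> carrier A" "b \<in> carrier A" "g a = g b" "a \<noteq> b"
    then have i: "(a, b) \<in> I" by (simp add: I_def)
    have "H (a, b) a = H (a, b) b" using fun_cong[OF ab(3), of "(a, b)"] i by (simp add: g_def)
    then show False using F[OF i] by simp
  qed
  then have "bij_betw g (carrier A) (g ` carrier A)" by (rule inj_on_imp_bij_betw)
  moreover have "\<forall>i\<in>I. residuated_lattice (F i) \<and> totally_ordered (F i)" using F by blast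
  ultimately show ?thesis
    unfolding semilinear_def P_def by blast
qed

section \<open>Prelinear integral residuated lattices are semilinear\<close>

text \<open>An entry \<open>(True, a)\<close> stands for \<open>z \<mapsto> a \ (za)\<close> and \<open>(False, a)\<close> for \<open>z \<mapsto> (az) / a\<close>.\<close>

fun iterated_conjugate :: "'a rl \<Rightarrow> (bool \<times> 'a) list \<Rightarrow> 'a \<Rightarrow> 'a"
  where
    "iterated_conjugate L [] z = z"
  | "iterated_conjugate L ((True, a) # cs) z = lres L a (iterated_conjugate L cs z \<otimes>\<^bsub>L\<^esub> a)"
  | "iterated_conjugate L ((False, a) # cs) z = rres L (a \<otimes>\<^bsub>L\<^esub> iterated_conjugate L cs z) a"

text \<open>In an integral chain one of \<open>x \ y\<close> and \<open>y \ x\<close> is the unit, and so are all its conjugates;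
  hence the identities below hold in every semilinear integral residuated lattice. The
  conjugates are there because filters have to be closed under conjugation to define
  congruences.\<close>

definition prelinear :: "'a rl \<Rightarrow> bool"
  where "prelinear L \<longleftrightarrow> (\<forall>x\<in>carrier L. \<forall>y\<in>carrier L.
    \<forall>cs\<in>lists (UNIV \<times> carrier L). \<forall>ds\<in>lists (UNIV \<times> carrier L).
      iterated_conjugate L cs (lres L x y) \<^bold>\<or>\<^bsub>L\<^esub> iterated_conjugate L ds (lres L y x) = \<one>\<^bsub>L\<^esub>)"

fun conjugate_term :: "(bool \<times> 'v) list \<Rightarrow> 'v rl_term \<Rightarrow> 'v rl_term"
  where
    "conjugate_term [] t = t"
  | "conjugate_term ((True, a) # cs) t = LDiv (Var a) (Times (conjugate_term cs t) (Var a))"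
  | "conjugate_term ((False, a) # cs) t = RDiv (Times (Var a) (conjugate_term cs t)) (Var a)"

lemma rl_eval_conjugate_term:
  "rl_eval L v (conjugate_term cs t) = iterated_conjugate L (map (apsnd v) cs) (rl_eval L v t)"
  by (induction cs t rule: conjugate_term.induct) simp_all

lemma prelinear_inherited:
  fixes A :: "'a rl" and K :: "'b rl set"
  assumes A: "satisfies_identities_of A K" and K: "\<And>B. B \<in> K \<Longrightarrow> prelinear B"
  shows "prelinear A"
  unfolding prelinear_def
proof (intro ballI)
  fix x y and cs ds :: "(bool \<times> _) list"
  assume xy: "x \<in> carrier A" "y \<in> carrier A"
    and cs: "cs \<in> lists (UNIV \<times> carrier A)" and ds: "ds \<in> lists (UNIV \<times> carrier A)"
  have id: "map (apsnd (self_assignment A)) es = es" if "es \<in> lists (UNIV \<times> carrier A)"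
    for es :: "(bool \<times> _) list"
    using that by (induction es) auto
  have "rl_eval A (self_assignment A)
      (Join (conjugate_term cs (LDiv (Var x) (Var y))) (conjugate_term ds (LDiv (Var y) (Var x)))) =
    rl_eval A (self_assignment A) Unit"
  proof (rule identity_inherited[OF A])
    fix B :: "'b rl" and v :: "'a \<Rightarrow> 'b"
    assume B: "B \<in> K" and v: "range v \<subseteq> carrier B"
    have "map (apsnd v) es \<in> lists (UNIV \<times> carrier B)" for es :: "(bool \<times> _) list"
      using v by (induction es) (auto simp: image_subset_iff)
    moreover have "v x \<in> carrier B" "v y \<in> carrier B" using v by auto
    ultimately have "iterated_conjugate B (map (apsnd v) cs) (lres B (v x) (v y)) \<^bold>\<or>\<^bsub>B\<^esub>
        iterated_conjugate B (map (apsnd v) ds) (lres B (v y) (v x)) = \<one>\<^bsub>B\<^esub>"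
      using K[OF B] unfolding prelinear_def by blast
    then show "rl_eval B v
        (Join (conjugate_term cs (LDiv (Var x) (Var y))) (conjugate_term ds (LDiv (Var y) (Var x)))) =
      rl_eval B v Unit"
      by (simp add: rl_eval_conjugate_term)
  qed
  then show "iterated_conjugate A cs (lres A x y) \<^bold>\<or>\<^bsub>A\<^esub> iterated_conjugate A ds (lres A y x) = \<one>\<^bsub>A\<^esub>"
    using xy by (simp add: rl_eval_conjugate_term id[OF cs] id[OF ds])
qed

locale integral_residuated_lattice = residuated_lattice +
  assumes integral: "integral L"
begin

lemma le_one [simp]: "x \<in> carrier L \<Longrightarrow> x \<preceq> \<one>"
  using integral by (simp add: integral_def rl_le_def)

lemma one_le_iff: "x \<in> carrier L \<Longrightarrow> \<one> \<preceq> x \<longleftrightarrow> x = \<one>"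
  using le_antisym[of x \<one>] by auto

lemma mult_le1: "\<lbrakk>x \<in> carrier L; y \<in> carrier L\<rbrakk> \<Longrightarrow> x \<otimes> y \<preceq> x"
  using mult_left_mono[of y \<one> x] by simp

lemma mult_le2: "\<lbrakk>x \<in> carrier L; y \<in> carrier L\<rbrakk> \<Longrightarrow> x \<otimes> y \<preceq> y"
  using mult_right_mono[of x \<one> y] by simp

lemma join_one: "x \<in> carrier L \<Longrightarrow> x \<^bold>\<or> \<one> = \<one>" "x \<in> carrier L \<Longrightarrow> \<one> \<^bold>\<or> x = \<one>"
  using le_iff_join[of x \<one>] by (simp_all add: join_comm)

lemma lres_one_iff:
  assumes "x \<in> carrier L" "y \<in> carrier L"
  shows "lres L x y = \<one> \<longleftrightarrow> x \<preceq> y"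
  using assms residuation_left[of x \<one> y] by (simp add: one_le_iff)

abbreviation conjugators :: "(bool \<times> 'a) list set"
  where "conjugators \<equiv> lists (UNIV \<times> carrier L)"

lemma iterated_conjugate_closed [simp]:
  "\<lbrakk>cs \<in> conjugators; z \<in> carrier L\<rbrakk> \<Longrightarrow> iterated_conjugate L cs z \<in> carrier L"
proof (induction cs)
  case (Cons c cs)
  obtain d a where "c = (d, a)" by fastforce
  then show ?case using Cons by (cases d) simp_all
qed simp

lemma iterated_conjugate_append:
  "iterated_conjugate L (cs @ ds) z = iterated_conjugate L cs (iterated_conjugate L ds z)"
  by (induction L cs z rule: iterated_conjugate.induct) simp_all

lemma residual_self:
  assumes "a \<in> carrier L"
  shows "lres L a a = \<one>" "rres L a a = \<one>"
  using assms residuation_left[of a \<one> a] residuation_right[of \<one> a a]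
  by (simp_all add: one_le_iff)

lemma iterated_conjugate_one:
  "cs \<in> conjugators \<Longrightarrow> iterated_conjugate L cs \<one> = \<one>"
proof (induction cs)
  case (Cons c cs)
  obtain d a where c: "c = (d, a)" by fastforce
  have "a \<in> carrier L" using Cons.prems c by simp
  then show ?case using Cons c by (cases d) (simp_all add: residual_self)
qed simp

lemma iterated_conjugate_mono:
  assumes "x \<preceq> y" "x \<in> carrier L" "y \<in> carrier L" "cs \<in> conjugators"
  shows "iterated_conjugate L cs x \<preceq> iterated_conjugate L cs y"
  using assms(4)
proof (induction cs)
  case (Cons c cs)
  obtain d a where c: "c = (d, a)" by fastforce
  let ?x = "iterated_conjugate L cs x" and ?y = "iterated_conjugate L cs y"
  have a: "a \<in> carrier L" and xy: "?x \<in> carrier L" "?y \<in> carrier L" "?x \<preceq> ?y"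
    using Cons assms c by simp_all
  have "lres L a (?x \<otimes> a) \<preceq> lres L a (?y \<otimes> a)"
    using le_trans[OF lres_le mult_right_mono[OF xy(3)]] a xy by (simp flip: residuation_left)
  moreover have "rres L (a \<otimes> ?x) a \<preceq> rres L (a \<otimes> ?y) a"
    using le_trans[OF rres_le mult_left_mono[OF xy(3)]] a xy by (simp flip: residuation_right)
  ultimately show ?case
    using c by (cases d) simp_all
qed (use assms in simp)

lemma iterated_conjugate_mult:
  assumes "x \<in> carrier L" "y \<in> carrier L" "cs \<in> conjugators"
  shows "iterated_conjugate L cs x \<otimes> iterated_conjugate L cs y \<preceq> iterated_conjugate L cs (x \<otimes> y)"
  using assms(3)
proof (induction cs)
  case (Cons c cs)
  obtain d a where c: "c = (d, a)" by fastforce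
  let ?x = "iterated_conjugate L cs x" and ?y = "iterated_conjugate L cs y"
    and ?z = "iterated_conjugate L cs (x \<otimes> y)"
  have a: "a \<in> carrier L" and cl: "?x \<in> carrier L" "?y \<in> carrier L" "?z \<in> carrier L"
    and IH: "?x \<otimes> ?y \<preceq> ?z"
    using Cons assms c by simp_all
  let ?l = "lres L a (?x \<otimes> a)" and ?l' = "lres L a (?y \<otimes> a)"
  have l1: "a \<otimes> (?l \<otimes> ?l') \<preceq> ?x \<otimes> (a \<otimes> ?l')"
    using mult_right_mono[OF lres_le, of a "?x \<otimes> a" ?l'] a cl by (simp add: m_assoc)
  have l2: "?x \<otimes> (a \<otimes> ?l') \<preceq> ?x \<otimes> (?y \<otimes> a)"
    using mult_left_mono[OF lres_le, of a "?y \<otimes> a" ?x] a cl by simp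
  have l3: "?x \<otimes> (?y \<otimes> a) \<preceq> ?z \<otimes> a"
    using mult_right_mono[OF IH, of a] a cl by (simp add: m_assoc)
  have l: "?l \<otimes> ?l' \<preceq> lres L a (?z \<otimes> a)"
    using le_trans[OF le_trans[OF l1 l2] l3] a cl by (simp flip: residuation_left)
  let ?r = "rres L (a \<otimes> ?x) a" and ?r' = "rres L (a \<otimes> ?y) a"
  have r1: "(?r \<otimes> ?r') \<otimes> a \<preceq> ?r \<otimes> (a \<otimes> ?y)"
    using mult_left_mono[OF rres_le, of a "a \<otimes> ?y" ?r] a cl by (simp add: m_assoc)
  have r2: "?r \<otimes> (a \<otimes> ?y) \<preceq> (a \<otimes> ?x) \<otimes> ?y"
    using mult_right_mono[OF rres_le, of a "a \<otimes> ?x" ?y] a cl by (simp add: m_assoc)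
  have r3: "(a \<otimes> ?x) \<otimes> ?y \<preceq> a \<otimes> ?z"
    using mult_left_mono[OF IH, of a] a cl by (simp add: m_assoc)
  have r: "?r \<otimes> ?r' \<preceq> rres L (a \<otimes> ?z) a"
    using le_trans[OF le_trans[OF r1 r2] r3] a cl by (simp flip: residuation_right)
  show ?case
    using l r c by (cases d) simp_all
qed (use assms in simp)

lemma totally_ordered_imp_prelinear:
  assumes "totally_ordered L"
  shows "prelinear L"
  unfolding prelinear_def
proof (intro ballI)
  fix x y cs ds
  assume *: "x \<in> carrier L" "y \<in> carrier L" "cs \<in> conjugators" "ds \<in> conjugators"
  then have "lres L x y = \<one> \<or> lres L y x = \<one>"
    using assms by (simp add: lres_one_iff totally_ordered_def)
  then show "iterated_conjugate L cs (lres L x y) \<^bold>\<or> iterated_conjugate L ds (lres L y x) = \<one>"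
    by (rule disjE) (use * in \<open>simp_all add: iterated_conjugate_one join_one\<close>)
qed

definition normal_filter :: "'a set \<Rightarrow> bool"
  where "normal_filter P \<longleftrightarrow> P \<subseteq> carrier L \<and> \<one> \<in> P \<and> (\<forall>p\<in>P. \<forall>q\<in>P. p \<otimes> q \<in> P) \<and>
    (\<forall>p\<in>P. \<forall>q\<in>carrier L. p \<preceq> q \<longrightarrow> q \<in> P) \<and>
    (\<forall>p\<in>P. \<forall>a\<in>carrier L. lres L a (p \<otimes> a) \<in> P \<and> rres L (a \<otimes> p) a \<in> P)"

lemma normal_filterD:
  assumes "normal_filter P"
  shows "P \<subseteq> carrier L" "\<one> \<in> P" "\<And>p q. \<lbrakk>p \<in> P; q \<in> P\<rbrakk> \<Longrightarrow> p \<otimes> q \<in> P"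
    "\<And>p q. \<lbrakk>p \<in> P; p \<preceq> q; q \<in> carrier L\<rbrakk> \<Longrightarrow> q \<in> P"
    "\<And>p a. \<lbrakk>p \<in> P; a \<in> carrier L\<rbrakk> \<Longrightarrow> lres L a (p \<otimes> a) \<in> P"
    "\<And>p a. \<lbrakk>p \<in> P; a \<in> carrier L\<rbrakk> \<Longrightarrow> rres L (a \<otimes> p) a \<in> P"
  using assms unfolding normal_filter_def by blast+

lemma normal_filter_conjugate:
  assumes "normal_filter P" "p \<in> P" "cs \<in> conjugators"
  shows "iterated_conjugate L cs p \<in> P"
  using assms(3)
proof (induction cs)
  case (Cons c cs)
  obtain d a where "c = (d, a)" by fastforce
  then show ?case
    using Cons normal_filterD(5,6)[OF assms(1)] by (cases d) simp_all
qed (use assms in simp)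

lemma normal_filter_one: "normal_filter {\<one>}"
  by (simp add: normal_filter_def one_le_iff residual_self)

text \<open>This is what makes polars closed under multiplication.\<close>

lemma mult_join_le:
  assumes "u \<in> carrier L" "v \<in> carrier L" "x \<in> carrier L"
  shows "(u \<^bold>\<or> x) \<otimes> (v \<^bold>\<or> x) \<preceq> u \<otimes> v \<^bold>\<or> x"
proof -
  let ?w = "u \<otimes> v \<^bold>\<or> x"
  have le: "s \<preceq> ?w" if "s \<preceq> x" "s \<in> carrier L" for s
    using that assms le_trans[OF _ join_ge2] by simp
  have "v \<preceq> lres L u ?w" "x \<preceq> lres L u ?w"
    using assms by (simp_all add: join_ge1 le mult_le2 flip: residuation_left)
  then have "v \<^bold>\<or> x \<preceq> lres L u ?w" using assms by (simp add: join_leI)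
  then have "u \<preceq> rres L ?w (v \<^bold>\<or> x)"
    using assms by (simp add: residuation_left flip: residuation_right)
  moreover have "x \<preceq> rres L ?w (v \<^bold>\<or> x)"
    using assms by (simp add: le mult_le1 flip: residuation_right)
  ultimately have "u \<^bold>\<or> x \<preceq> rres L ?w (v \<^bold>\<or> x)" using assms by (simp add: join_leI)
  then show ?thesis using assms by (simp add: residuation_right)
qed

lemma join_mono_left:
  assumes "x \<preceq> y" "x \<in> carrier L" "y \<in> carrier L" "z \<in> carrier L"
  shows "x \<^bold>\<or> z \<preceq> y \<^bold>\<or> z"
  using assms le_trans[OF assms(1) join_ge1[of y z]] by (simp add: join_leI join_ge2)

text \<open>The elements orthogonal to \<open>q\<close> modulo \<open>P\<close>. Orthogonality is asked of all iterated conjugates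
  of both elements, which makes the relation symmetric and polars closed under conjugation.\<close>

definition polar :: "'a set \<Rightarrow> 'a \<Rightarrow> 'a set"
  where "polar P q = {z \<in> carrier L. \<forall>cs\<in>conjugators. \<forall>ds\<in>conjugators.
    iterated_conjugate L cs z \<^bold>\<or> iterated_conjugate L ds q \<in> P}"

lemma polar_sym:
  "\<lbrakk>z \<in> polar P q; q \<in> carrier L\<rbrakk> \<Longrightarrow> q \<in> polar P z"
  unfolding polar_def by (auto simp: join_comm[of "iterated_conjugate L _ q"])

lemma normal_filter_polar:
  assumes P: "normal_filter P" and q: "q \<in> carrier L"
  shows "normal_filter (polar P q)"
  unfolding normal_filter_def
proof (intro conjI ballI impI)
  show "polar P q \<subseteq> carrier L" by (auto simp: polar_def)
  show "\<one> \<in> polar P q"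
    using q normal_filterD(2)[OF P] by (simp add: polar_def iterated_conjugate_one join_one)
next
  fix z z' assume z: "z \<in> polar P q" and z': "z' \<in> polar P q"
  then have cl: "z \<in> carrier L" "z' \<in> carrier L" by (auto simp: polar_def)
  have "iterated_conjugate L cs (z \<otimes> z') \<^bold>\<or> iterated_conjugate L ds q \<in> P"
    if cd: "cs \<in> conjugators" "ds \<in> conjugators" for cs ds
  proof -
    let ?u = "iterated_conjugate L cs z" and ?v = "iterated_conjugate L cs z'"
      and ?w = "iterated_conjugate L cs (z \<otimes> z')" and ?x = "iterated_conjugate L ds q"
    have c: "?u \<in> carrier L" "?v \<in> carrier L" "?w \<in> carrier L" "?x \<in> carrier L"
      using cd cl q by simp_all
    have "(?u \<^bold>\<or> ?x) \<otimes> (?v \<^bold>\<or> ?x) \<in> P"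
      using z z' cd normal_filterD(3)[OF P] by (auto simp: polar_def)
    moreover have "(?u \<^bold>\<or> ?x) \<otimes> (?v \<^bold>\<or> ?x) \<preceq> ?w \<^bold>\<or> ?x"
      using le_trans[OF mult_join_le join_mono_left[OF iterated_conjugate_mult]] c cl cd by simp
    ultimately show ?thesis
      using normal_filterD(4)[OF P] c by simp
  qed
  then show "z \<otimes> z' \<in> polar P q"
    using cl by (simp add: polar_def)
next
  fix z z' assume z: "z \<in> polar P q" and z': "z' \<in> carrier L" "z \<preceq> z'"
  then have cl: "z \<in> carrier L" by (auto simp: polar_def)
  have "iterated_conjugate L cs z' \<^bold>\<or> iterated_conjugate L ds q \<in> P"
    if cd: "cs \<in> conjugators" "ds \<in> conjugators" for cs ds
  proof (rule normal_filterD(4)[OF P])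
    show "iterated_conjugate L cs z \<^bold>\<or> iterated_conjugate L ds q \<in> P"
      using z cd unfolding polar_def by blast
    show "iterated_conjugate L cs z \<^bold>\<or> iterated_conjugate L ds q \<preceq>
        iterated_conjugate L cs z' \<^bold>\<or> iterated_conjugate L ds q"
      using z' cl cd q by (simp add: join_mono_left iterated_conjugate_mono)
  qed (use z' cd q in simp)
  then show "z' \<in> polar P q"
    using z' by (simp add: polar_def)
next
  fix z a assume z: "z \<in> polar P q" and a: "a \<in> carrier L"
  have z': "z \<in> carrier L" using z by (simp add: polar_def)
  have conj: "iterated_conjugate L (cs @ [(d, a)]) z \<^bold>\<or> iterated_conjugate L ds q \<in> P"
    if cd: "cs \<in> conjugators" "ds \<in> conjugators" for cs ds d
  proof -
    have "cs @ [(d, a)] \<in> conjugators" using cd a by simp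
    then show ?thesis using z cd unfolding polar_def by blast
  qed
  show "lres L a (z \<otimes> a) \<in> polar P q" "rres L (a \<otimes> z) a \<in> polar P q"
    using conj[where d = True] conj[where d = False] a z'
    by (simp_all add: polar_def iterated_conjugate_append)
qed

lemma subset_polar:
  assumes P: "normal_filter P" and q: "q \<in> carrier L"
  shows "P \<subseteq> polar P q"
proof
  fix p assume p: "p \<in> P"
  then have p': "p \<in> carrier L" using normal_filterD(1)[OF P] by blast
  have "iterated_conjugate L cs p \<^bold>\<or> iterated_conjugate L ds q \<in> P"
    if cd: "cs \<in> conjugators" "ds \<in> conjugators" for cs ds
    by (rule normal_filterD(4)[OF P normal_filter_conjugate[OF P p cd(1)]])
      (use p' q cd in \<open>simp_all add: join_ge1\<close>)
  then show "p \<in> polar P q" using p' by (simp add: polar_def)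
qed

text \<open>A normal filter that is maximal for missing \<open>c\<close> is prime: if \<open>p\<close> and \<open>q\<close> are orthogonal and
  neither lies in \<open>P\<close>, the polar of \<open>q\<close> contains \<open>p\<close> and so, by maximality, \<open>c\<close>; then the polar of
  \<open>c\<close> contains \<open>q\<close> and so \<open>c\<close>, which means that \<open>c = c \<or> c\<close> belongs to \<open>P\<close>.\<close>

lemma maximal_normal_filter_prime:
  assumes P: "normal_filter P" and c: "c \<in> carrier L" "c \<notin> P"
    and max: "\<And>Q. \<lbrakk>normal_filter Q; P \<subseteq> Q; c \<notin> Q\<rbrakk> \<Longrightarrow> Q = P"
    and q: "q \<in> carrier L" and orth: "p \<in> polar P q"
  shows "p \<in> P \<or> q \<in> P"
proof (rule ccontr)
  assume not: "\<not> (p \<in> P \<or> q \<in> P)"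
  have "c \<in> polar P q"
    using max[OF normal_filter_polar[OF P q] subset_polar[OF P q]] orth not by blast
  then have "q \<in> polar P c" by (rule polar_sym[OF _ q])
  then have "c \<in> polar P c"
    using max[OF normal_filter_polar[OF P c(1)] subset_polar[OF P c(1)]] not by blast
  then have "iterated_conjugate L [] c \<^bold>\<or> iterated_conjugate L [] c \<in> P"
    unfolding polar_def by blast
  then show False
    using c le_iff_join[of c c] by simp
qed

lemma ex_maximal_normal_filter:
  assumes c: "c \<noteq> \<one>"
  obtains P where "normal_filter P" "c \<notin> P"
    "\<And>Q. \<lbrakk>normal_filter Q; P \<subseteq> Q; c \<notin> Q\<rbrakk> \<Longrightarrow> Q = P"
proof -
  let ?N = "{P. normal_filter P \<and> c \<notin> P}"
  have "\<exists>M\<in>?N. \<forall>X\<in>?N. M \<subseteq> X \<longrightarrow> X = M"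
  proof (rule subset_Zorn_nonempty)
    show "?N \<noteq> {}" using c normal_filter_one by blast
  next
    fix C assume C: "C \<noteq> {}" "subset.chain ?N C"
    then have N: "\<And>P. P \<in> C \<Longrightarrow> normal_filter P" and cN: "\<And>P. P \<in> C \<Longrightarrow> c \<notin> P"
      and ch: "\<And>P Q. P \<in> C \<Longrightarrow> Q \<in> C \<Longrightarrow> P \<subseteq> Q \<or> Q \<subseteq> P"
      unfolding subset.chain_def by blast+
    have "p \<otimes> q \<in> \<Union>C" if pq: "p \<in> \<Union>C" "q \<in> \<Union>C" for p q
    proof -
      obtain P Q where PQ: "P \<in> C" "Q \<in> C" "p \<in> P" "q \<in> Q" using pq by blast
      then have "p \<otimes> q \<in> P \<or> p \<otimes> q \<in> Q"
        using ch[of P Q] normal_filterD(3)[OF N] by blast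
      then show ?thesis using PQ by blast
    qed
    moreover have "\<Union>C \<subseteq> carrier L" "\<one> \<in> \<Union>C"
      using C(1) normal_filterD(1,2)[OF N] by blast+
    moreover have "q \<in> \<Union>C" if "p \<in> \<Union>C" "q \<in> carrier L" "p \<preceq> q" for p q
      using that normal_filterD(4)[OF N] by blast
    moreover have "lres L a (p \<otimes> a) \<in> \<Union>C" "rres L (a \<otimes> p) a \<in> \<Union>C"
      if pa: "p \<in> \<Union>C" "a \<in> carrier L" for p a
    proof -
      obtain P where Q: "P \<in> C" "p \<in> P" using pa(1) by blast
      from normal_filterD(5,6)[OF N[OF Q(1)] Q(2) pa(2)] Q(1)
      show "lres L a (p \<otimes> a) \<in> \<Union>C" "rres L (a \<otimes> p) a \<in> \<Union>C" by auto
    qed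
    ultimately have "normal_filter (\<Union>C)"
      by (simp add: normal_filter_def)
    then show "\<Union>C \<in> ?N" using cN by blast
  qed
  then show ?thesis using that by blast
qed

text \<open>The order of the quotient by \<open>P\<close>, pulled back to \<open>L\<close>.\<close>

definition le_mod :: "'a set \<Rightarrow> 'a \<Rightarrow> 'a \<Rightarrow> bool"
  where "le_mod P x y \<longleftrightarrow> x \<in> carrier L \<and> y \<in> carrier L \<and> (\<exists>p\<in>P. x \<otimes> p \<preceq> y)"

text \<open>Normality lets the element of \<open>P\<close> move to the other side of \<open>x\<close>: if \<open>xp \<preceq> y\<close> then
  \<open>((xp) / x) x \<preceq> y\<close>. With a witness on either side at hand, the order modulo \<open>P\<close> is compatible
  with multiplication from the left and from the right.\<close>

lemma le_mod_iff_left: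
  assumes P: "normal_filter P"
  shows "le_mod P x y \<longleftrightarrow> x \<in> carrier L \<and> y \<in> carrier L \<and> (\<exists>p\<in>P. p \<otimes> x \<preceq> y)"
proof (cases "x \<in> carrier L \<and> y \<in> carrier L")
  case True
  note N = normal_filterD[OF P]
  have "\<exists>q\<in>P. q \<otimes> x \<preceq> y" if "p \<in> P" "x \<otimes> p \<preceq> y" for p
    using that True N(1) le_trans[OF rres_le[of x "x \<otimes> p"] that(2)]
    by (intro bexI[OF _ N(6)[of p x]]) auto
  moreover have "\<exists>q\<in>P. x \<otimes> q \<preceq> y" if "p \<in> P" "p \<otimes> x \<preceq> y" for p
    using that True N(1) le_trans[OF lres_le[of x "p \<otimes> x"] that(2)]
    by (intro bexI[OF _ N(5)[of p x]]) auto
  ultimately show ?thesis using True unfolding le_mod_def by blast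
qed (auto simp: le_mod_def)

lemma le_mod_iff_lres:
  assumes P: "normal_filter P" and xy: "x \<in> carrier L" "y \<in> carrier L"
  shows "le_mod P x y \<longleftrightarrow> lres L x y \<in> P"
proof
  assume "le_mod P x y"
  then obtain p where p: "p \<in> P" "x \<otimes> p \<preceq> y" by (auto simp: le_mod_def)
  then have "p \<preceq> lres L x y" using xy normal_filterD(1)[OF P] by (auto simp: residuation_left)
  then show "lres L x y \<in> P" using p xy normal_filterD(4)[OF P] by simp
next
  assume "lres L x y \<in> P"
  then show "le_mod P x y" using xy lres_le by (auto simp: le_mod_def)
qed

context
  fixes P
  assumes P: "normal_filter P"
begin

lemma in_carrier: "p \<in> P \<Longrightarrow> p \<in> carrier L"
  using normal_filterD(1)[OF P] by blast

lemma le_modE_left: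
  assumes "le_mod P x y"
  obtains p where "p \<in> P" "p \<in> carrier L" "p \<otimes> x \<preceq> y" "x \<in> carrier L" "y \<in> carrier L"
  using assms in_carrier unfolding le_mod_iff_left[OF P] by blast

lemma le_modE:
  assumes "le_mod P x y"
  obtains p where "p \<in> P" "p \<in> carrier L" "x \<otimes> p \<preceq> y" "x \<in> carrier L" "y \<in> carrier L"
  using assms in_carrier unfolding le_mod_def by blast

lemma le_imp_le_mod: "\<lbrakk>x \<preceq> y; x \<in> carrier L; y \<in> carrier L\<rbrakk> \<Longrightarrow> le_mod P x y"
  using normal_filterD(2)[OF P] by (auto simp: le_mod_def intro!: bexI[of _ \<one>])

lemma le_mod_trans:
  assumes "le_mod P x y" "le_mod P y z"
  shows "le_mod P x z"
proof -
  obtain p where p: "p \<in> P" "p \<in> carrier L" "x \<otimes> p \<preceq> y" "x \<in> carrier L" "y \<in> carrier L"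
    using assms(1) by (rule le_modE)
  obtain q where q: "q \<in> P" "q \<in> carrier L" "y \<otimes> q \<preceq> z" "z \<in> carrier L"
    using assms(2) by (rule le_modE)
  have "x \<otimes> (p \<otimes> q) \<preceq> y \<otimes> q"
    using mult_right_mono[OF p(3), of q] p q by (simp add: m_assoc)
  then have "x \<otimes> (p \<otimes> q) \<preceq> z" using le_trans[OF _ q(3)] p q by simp
  then show ?thesis using p q normal_filterD(3)[OF P] unfolding le_mod_def by blast
qed

lemma le_mod_mult_right:
  assumes "le_mod P x y" "u \<in> carrier L"
  shows "le_mod P (x \<otimes> u) (y \<otimes> u)"
proof -
  obtain p where p: "p \<in> P" "p \<in> carrier L" "p \<otimes> x \<preceq> y" "x \<in> carrier L" "y \<in> carrier L"
    using assms(1) by (rule le_modE_left)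
  have "p \<otimes> (x \<otimes> u) \<preceq> y \<otimes> u"
    using mult_right_mono[OF p(3), of u] p assms(2) by (simp add: m_assoc)
  then show ?thesis using p assms(2) unfolding le_mod_iff_left[OF P] by auto
qed

lemma le_mod_mult_left:
  assumes "le_mod P x y" "u \<in> carrier L"
  shows "le_mod P (u \<otimes> x) (u \<otimes> y)"
proof -
  obtain p where p: "p \<in> P" "p \<in> carrier L" "x \<otimes> p \<preceq> y" "x \<in> carrier L" "y \<in> carrier L"
    using assms(1) by (rule le_modE)
  have "(u \<otimes> x) \<otimes> p \<preceq> u \<otimes> y"
    using mult_left_mono[OF p(3), of u] p assms(2) by (simp add: m_assoc)
  then show ?thesis using p assms(2) unfolding le_mod_def by auto
qed

lemma le_mod_meetI:
  assumes "le_mod P z x" "le_mod P z y"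
  shows "le_mod P z (x \<^bold>\<and> y)"
proof -
  obtain p where p: "p \<in> P" "p \<in> carrier L" "z \<otimes> p \<preceq> x" "z \<in> carrier L" "x \<in> carrier L"
    using assms(1) by (rule le_modE)
  obtain q where q: "q \<in> P" "q \<in> carrier L" "z \<otimes> q \<preceq> y" "y \<in> carrier L"
    using assms(2) by (rule le_modE)
  have "z \<otimes> (p \<otimes> q) \<preceq> z \<otimes> p" "z \<otimes> (p \<otimes> q) \<preceq> z \<otimes> q"
    using p q by (simp_all add: mult_left_mono mult_le1 mult_le2)
  then have "z \<otimes> (p \<otimes> q) \<preceq> x \<^bold>\<and> y"
    using p q le_trans[OF _ p(3)] le_trans[OF _ q(3)] by (simp add: le_meetI)
  then show ?thesis using p q normal_filterD(3)[OF P] unfolding le_mod_def by auto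
qed

lemma le_mod_joinI:
  assumes "le_mod P x z" "le_mod P y z"
  shows "le_mod P (x \<^bold>\<or> y) z"
proof -
  obtain p where p: "p \<in> P" "p \<in> carrier L" "p \<otimes> x \<preceq> z" "z \<in> carrier L" "x \<in> carrier L"
    using assms(1) by (rule le_modE_left)
  obtain q where q: "q \<in> P" "q \<in> carrier L" "q \<otimes> y \<preceq> z" "y \<in> carrier L"
    using assms(2) by (rule le_modE_left)
  have "(p \<otimes> q) \<otimes> x \<preceq> p \<otimes> x" "(p \<otimes> q) \<otimes> y \<preceq> q \<otimes> y"
    using p q by (simp_all add: mult_right_mono mult_le1 mult_le2)
  then have "(p \<otimes> q) \<otimes> x \<preceq> z" "(p \<otimes> q) \<otimes> y \<preceq> z"
    using p q le_trans[OF _ p(3)] le_trans[OF _ q(3)] by simp_all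
  then have "(p \<otimes> q) \<otimes> (x \<^bold>\<or> y) \<preceq> z"
    using p q by (simp add: residuation_left join_leI)
  then show ?thesis using p q normal_filterD(3)[OF P] unfolding le_mod_iff_left[OF P] by auto
qed

text \<open>Residuals are determined by the order and multiplication, also modulo \<open>P\<close>.\<close>

lemma le_mod_residuation:
  assumes "a \<in> carrier L" "b \<in> carrier L" "d \<in> carrier L"
  shows "le_mod P b (lres L a d) \<longleftrightarrow> le_mod P (a \<otimes> b) d"
    and "le_mod P a (rres L d b) \<longleftrightarrow> le_mod P (a \<otimes> b) d"
proof -
  have "p \<in> P \<Longrightarrow> b \<otimes> p \<preceq> lres L a d \<longleftrightarrow> (a \<otimes> b) \<otimes> p \<preceq> d" for p
    using assms in_carrier[of p] by (simp add: m_assoc flip: residuation_left)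
  then show "le_mod P b (lres L a d) \<longleftrightarrow> le_mod P (a \<otimes> b) d"
    using assms by (auto simp: le_mod_def)
  have "p \<in> P \<Longrightarrow> p \<otimes> a \<preceq> rres L d b \<longleftrightarrow> p \<otimes> (a \<otimes> b) \<preceq> d" for p
    using assms in_carrier[of p] by (simp add: m_assoc flip: residuation_right)
  then show "le_mod P a (rres L d b) \<longleftrightarrow> le_mod P (a \<otimes> b) d"
    using assms by (auto simp: le_mod_iff_left[OF P])
qed

definition eq_mod :: "'a \<Rightarrow> 'a \<Rightarrow> bool"
  where "eq_mod x y \<longleftrightarrow> le_mod P x y \<and> le_mod P y x"

lemma le_mod_ops:
  assumes xx: "le_mod P x x'" "le_mod P x' x" and yy: "le_mod P y y'"
  shows "le_mod P (x \<otimes> y) (x' \<otimes> y')" "le_mod P (x \<^bold>\<and> y) (x' \<^bold>\<and> y')" "le_mod P (x \<^bold>\<or> y) (x' \<^bold>\<or> y')"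
    "le_mod P (lres L x y) (lres L x' y')" "le_mod P (rres L y x) (rres L y' x')"
proof -
  have cl: "x \<in> carrier L" "x' \<in> carrier L" "y \<in> carrier L" "y' \<in> carrier L"
    using xx yy by (auto simp: le_mod_def)
  note le = le_imp_le_mod and tr = le_mod_trans
  show "le_mod P (x \<otimes> y) (x' \<otimes> y')"
    using tr[OF le_mod_mult_right[OF xx(1)] le_mod_mult_left[OF yy]] cl by simp
  show "le_mod P (x \<^bold>\<and> y) (x' \<^bold>\<and> y')"
    by (rule le_mod_meetI[OF tr[OF le xx(1)] tr[OF le yy]])
      (use cl in \<open>simp_all add: meet_le1 meet_le2\<close>)
  show "le_mod P (x \<^bold>\<or> y) (x' \<^bold>\<or> y')"
    by (rule le_mod_joinI[OF tr[OF xx(1) le] tr[OF yy le]])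
      (use cl in \<open>simp_all add: join_ge1 join_ge2\<close>)
  have "le_mod P (x' \<otimes> lres L x y) (x \<otimes> lres L x y)"
    using le_mod_mult_right[OF xx(2)] cl by simp
  then have "le_mod P (x' \<otimes> lres L x y) y'"
    using tr[OF tr[OF _ le[OF lres_le]] yy] cl by simp
  then show "le_mod P (lres L x y) (lres L x' y')"
    using cl by (simp add: le_mod_residuation)
  have "le_mod P (rres L y x \<otimes> x') (rres L y x \<otimes> x)"
    using le_mod_mult_left[OF xx(2)] cl by simp
  then have "le_mod P (rres L y x \<otimes> x') y'"
    using tr[OF tr[OF _ le[OF rres_le]] yy] cl by simp
  then show "le_mod P (rres L y x) (rres L y' x')"
    using cl by (simp add: le_mod_residuation)
qed

definition representative :: "'a \<Rightarrow> 'a"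
  where "representative x = (SOME z. eq_mod x z)"

lemma representative_eq_iff:
  assumes "x \<in> carrier L" "y \<in> carrier L"
  shows "representative x = representative y \<longleftrightarrow> eq_mod x y"
proof
  have rep: "eq_mod z (representative z)" if "z \<in> carrier L" for z
    unfolding representative_def by (rule someI[of _ z]) (simp add: eq_mod_def le_imp_le_mod that)
  show "eq_mod x y" if "representative x = representative y"
    using rep[OF assms(1)] rep[OF assms(2)] that le_mod_trans unfolding eq_mod_def by metis
  assume "eq_mod x y"
  then have "eq_mod x = eq_mod y"
    using le_mod_trans unfolding eq_mod_def fun_eq_iff by blast
  then show "representative x = representative y" by (simp add: representative_def)
qed

lemma representative_hom: "representative \<in> rl_hom L (rl_image representative L)"
proof (rule rl_image_hom)
  fix x x' y y'
  assume cl: "x \<in> carrier L" "x' \<in> carrier L" "y \<in> carrier L" "y' \<in> carrier L"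
    and "representative x = representative x'" "representative y = representative y'"
  then have "le_mod P x x'" "le_mod P x' x" "le_mod P y y'" "le_mod P y' y"
    by (simp_all add: representative_eq_iff eq_mod_def)
  then show "representative (x \<otimes> y) = representative (x' \<otimes> y') \<and>
      representative (x \<^bold>\<and> y) = representative (x' \<^bold>\<and> y') \<and>
      representative (x \<^bold>\<or> y) = representative (x' \<^bold>\<or> y') \<and>
      representative (lres L x y) = representative (lres L x' y') \<and>
      representative (rres L x y) = representative (rres L x' y')"
    using cl by (simp add: representative_eq_iff eq_mod_def le_mod_ops)
qed

end

text \<open>Semilinearity from prelinearity. Distinct \<open>a\<close> and \<open>b\<close> are separated by the quotient by a
  normal filter that is maximal for missing \<open>c = (a \ b) \<and> (b \ a)\<close>. Prelinearity makes \<open>x \ y\<close>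
  and \<open>y \ x\<close> orthogonal, so that one of them lies in the filter and the quotient is a chain.\<close>

lemma prelinear_imp_semilinear:
  assumes pre: "prelinear L"
  shows "semilinear L"
proof (rule semilinearI[OF closed_algebra])
  fix a b assume ab: "a \<in> carrier L" "b \<in> carrier L" "a \<noteq> b"
  define c where "c = lres L a b \<^bold>\<and> lres L b a"
  have c: "c \<in> carrier L" "c \<preceq> lres L a b" "c \<preceq> lres L b a"
    using ab by (simp_all add: c_def meet_le1 meet_le2)
  have "c \<noteq> \<one>"
    using c ab le_antisym[of a b] by (auto simp: one_le_iff lres_one_iff)
  then obtain P where P: "normal_filter P" "c \<notin> P"
    and max: "\<And>Q. \<lbrakk>normal_filter Q; P \<subseteq> Q; c \<notin> Q\<rbrakk> \<Longrightarrow> Q = P"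
    by (rule ex_maximal_normal_filter) blast
  let ?h = "representative P" and ?B = "rl_image (representative P) L"
  note hom = representative_hom[OF P(1)]
  have sat: "satisfies_identities_of ?B {L}"
    by (rule satisfies_identities_of_image[OF hom closed_algebra]) simp
  have "residuated_lattice ?B"
    by (rule residuated_lattice_inherited[OF sat]) (simp add: residuated_lattice_axioms)
  moreover have "totally_ordered ?B"
  proof (rule totally_ordered_image[OF hom])
    fix x y assume xy: "x \<in> carrier L" "y \<in> carrier L"
    have orth: "lres L x y \<in> polar P (lres L y x)"
      using pre xy normal_filterD(2)[OF P(1)] by (simp add: polar_def prelinear_def)
    have "lres L x y \<in> P \<or> lres L y x \<in> P"
      by (rule maximal_normal_filter_prime[OF P(1) c(1) P(2) max _ orth]) (use xy in simp_all)
    then have "le_mod P x y \<or> le_mod P y x"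
      using xy by (simp add: le_mod_iff_lres[OF P(1)])
    moreover have "?h (u \<^bold>\<and> v) = ?h u" if "le_mod P u v" "u \<in> carrier L" "v \<in> carrier L" for u v
      using that le_mod_meetI[OF P(1) le_imp_le_mod[OF P(1) le_refl] that(1)]
      by (simp add: representative_eq_iff[OF P(1)] eq_mod_def[OF P(1)] meet_le1
          le_imp_le_mod[OF P(1)])
    ultimately show "?h (x \<^bold>\<and> y) = ?h x \<or> ?h (y \<^bold>\<and> x) = ?h y" using xy by blast
  qed simp
  moreover have "?h a \<noteq> ?h b"
  proof
    assume "?h a = ?h b"
    then have "lres L a b \<in> P" "lres L b a \<in> P"
      using ab by (simp_all add: representative_eq_iff[OF P(1)] eq_mod_def[OF P(1)]
          flip: le_mod_iff_lres[OF P(1)])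
    then have "lres L a b \<otimes> lres L b a \<in> P" by (rule normal_filterD(3)[OF P(1)])
    moreover have "lres L a b \<otimes> lres L b a \<preceq> c"
      unfolding c_def using ab by (simp add: le_meetI mult_le1 mult_le2)
    ultimately show False
      using P(2) normal_filterD(4)[OF P(1)] c(1) by blast
  qed
  ultimately show "\<exists>(B :: 'a rl) h. residuated_lattice B \<and> totally_ordered B \<and> h \<in> rl_hom L B \<and>
        h ` carrier L = carrier B \<and> h a \<noteq> h b"
    using hom by (intro exI[of _ ?B] exI[of _ ?h]) simp
qed

end

section \<open>Finitely generated submonoids of integral chains\<close>

context integral_residuated_lattice
begin

definition word_value :: "'a list \<Rightarrow> 'a"
  where "word_value ws = foldr (\<otimes>) ws \<one>"

definition monoid_span :: "'a set \<Rightarrow> 'a set"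
  where "monoid_span X = word_value ` lists X"

lemma word_value_simps [simp]: "word_value [] = \<one>" "word_value (x # ws) = x \<otimes> word_value ws"
  by (simp_all add: word_value_def)

lemma word_value_closed: "ws \<in> lists X \<Longrightarrow> X \<subseteq> carrier L \<Longrightarrow> word_value ws \<in> carrier L"
  by (induction ws) auto

lemma word_value_append:
  assumes "us \<in> lists X" "ws \<in> lists X" "X \<subseteq> carrier L"
  shows "word_value (us @ ws) = word_value us \<otimes> word_value ws"
  using assms(1)
  by (induction us) (use assms in \<open>simp_all add: word_value_closed m_assoc subset_iff\<close>)

lemma monoid_span_subset: "X \<subseteq> carrier L \<Longrightarrow> monoid_span X \<subseteq> carrier L"
  unfolding monoid_span_def using word_value_closed by blast

lemma subset_monoid_span:
  assumes "X \<subseteq> carrier L"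
  shows "X \<subseteq> monoid_span X"
proof
  fix x assume x: "x \<in> X"
  then have "x = word_value [x]" using assms by auto
  then show "x \<in> monoid_span X"
    unfolding monoid_span_def by (rule image_eqI) (use x in simp)
qed

lemma submonoid_monoid_span:
  assumes X: "X \<subseteq> carrier L"
  shows "submonoid (monoid_span X) L"
proof
  show "monoid_span X \<subseteq> carrier L" by (rule monoid_span_subset[OF X])
  show "\<one> \<in> monoid_span X"
    unfolding monoid_span_def by (rule image_eqI[where x = "[]"]) simp_all
  fix x y assume "x \<in> monoid_span X" "y \<in> monoid_span X"
  then obtain us ws where "us \<in> lists X" "ws \<in> lists X" "x = word_value us" "y = word_value ws"
    unfolding monoid_span_def by blast
  then show "x \<otimes> y \<in> monoid_span X"
    unfolding monoid_span_def
    by (intro image_eqI[where x = "us @ ws"]) (simp_all add: word_value_append[OF _ _ X])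
qed

lemma countable_monoid_span: "finite X \<Longrightarrow> countable (monoid_span X)"
  unfolding monoid_span_def by (intro countable_image countable_lists countable_finite)

lemma monoid_span_minimal:
  assumes "X \<subseteq> H" "\<one> \<in> H" "\<And>x y. \<lbrakk>x \<in> H; y \<in> H\<rbrakk> \<Longrightarrow> x \<otimes> y \<in> H"
  shows "monoid_span X \<subseteq> H"
proof -
  have "word_value ws \<in> H" if "ws \<in> lists X" for ws
    using that by (induction ws) (use assms in auto)
  then show ?thesis unfolding monoid_span_def by blast
qed

definition strictly_below :: "'a \<Rightarrow> 'a \<Rightarrow> bool"  (infix \<open>\<prec>\<close> 50)
  where "x \<prec> y \<longleftrightarrow> x \<preceq> y \<and> x \<noteq> y"

lemma below_trans:
  "\<lbrakk>x \<prec> y; y \<prec> z; x \<in> carrier L; y \<in> carrier L; z \<in> carrier L\<rbrakk> \<Longrightarrow> x \<prec> z"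
  unfolding strictly_below_def by (metis le_antisym le_trans)

lemma not_le_iff_below:
  assumes "totally_ordered L" "x \<in> carrier L" "y \<in> carrier L"
  shows "\<not> y \<preceq> x \<longleftrightarrow> x \<prec> y"
  using assms le_antisym[of x y] by (auto simp: totally_ordered_def strictly_below_def)

text \<open>The ascending chain condition, by a minimal bad sequence argument; it is Higman's lemma, much
  simplified by the total order. In an ascending sequence whose terms are chosen one after the other with shortest
  possible words, infinitely many terms start with the same generator \<open>x\<close>. Dropping \<open>x\<close> from these
  leaves an ascending sequence, since the order is total, and its terms are not smaller than before,
  by integrality; so the first of them contradicts the choice of a shortest word.\<close>

lemma monoid_span_ascending_chain_condition:
  assumes tot: "totally_ordered L" and fin: "finite X" and X: "X \<subseteq> carrier L"
  shows "\<not> (\<exists>f. \<forall>n. f n \<in> monoid_span X \<and> f n \<prec> f (Suc n))"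
proof
  \<comment> \<open>\<open>N\<close> consists of the elements from which an ascending sequence starts, and \<open>shortest\<close> compares
      an element with all elements of \<open>N\<close> above it, not only with its successors in a sequence.\<close>
  define bad where "bad f \<longleftrightarrow> (\<forall>n::nat. f n \<in> monoid_span X \<and> f n \<prec> f (Suc n))" for f
  define N where "N = {f 0 |f. bad f}"
  define len where "len a = (LEAST n. \<exists>ws\<in>lists X. length ws = n \<and> word_value ws = a)" for a
  define shortest where "shortest a \<longleftrightarrow> (\<forall>b\<in>N. a \<preceq> b \<longrightarrow> len a \<le> len b)" for a
  have cl: "a \<in> carrier L" if "a \<in> monoid_span X" for a
    using that monoid_span_subset[OF X] by blast
  have N: "a \<in> monoid_span X" if "a \<in> N" for a
    using that by (auto simp: N_def bad_def)
  have next_N: "\<exists>b\<in>N. a \<prec> b" if a: "a \<in> N" for a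
  proof -
    obtain f where f: "bad f" "f 0 = a" using a by (auto simp: N_def)
    then have "bad (\<lambda>n. f (Suc n))" by (simp add: bad_def)
    then have "f (Suc 0) \<in> N" by (auto simp: N_def)
    then show ?thesis using f by (auto simp: bad_def)
  qed
  have next_shortest: "\<exists>b\<in>N. a \<prec> b \<and> shortest b" if a: "a \<in> N" for a
  proof -
    obtain b where b: "b \<in> N" "a \<prec> b" and min: "\<And>c. \<lbrakk>c \<in> N; a \<prec> c\<rbrakk> \<Longrightarrow> len b \<le> len c"
      using next_N[OF a] ex_has_least_nat[of "\<lambda>b. b \<in> N \<and> a \<prec> b" _ len] by blast
    have "a \<prec> c" if "b \<preceq> c" "c \<in> N" for c
      using that b below_trans[of a b c] cl[OF N[OF a]] cl[OF N[OF b(1)]] cl[OF N]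
      by (cases "b = c") (auto simp: strictly_below_def)
    then show ?thesis using b min by (auto simp: shortest_def)
  qed
  assume "\<exists>f. \<forall>n. f n \<in> monoid_span X \<and> f n \<prec> f (Suc n)"
  then obtain a where "a \<in> N" by (auto simp: N_def bad_def)
  then have "\<exists>b. b \<in> N \<and> shortest b" using next_shortest by blast
  then obtain g where g: "\<And>n. g n \<in> N \<and> shortest (g n)" "\<And>n. g n \<prec> g (Suc n)"
    using dependent_nat_choice[of "\<lambda>_ b. b \<in> N \<and> shortest b" "\<lambda>_ a b. a \<prec> b"] next_shortest
    by blast
  have gcl: "g n \<in> carrier L" for n using g(1) N cl by blast
  have g_mono: "g m \<prec> g n" if "m < n" for m n
    using that
  proof (induction n)
    case (Suc n)
    then show ?case
      using g(2)[of n] below_trans[of "g m" "g n" "g (Suc n)"] gcl by (cases "m = n") auto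
  qed simp
  have "\<exists>x u. x \<in> X \<and> u \<in> monoid_span X \<and> g n = x \<otimes> u \<and> len u < len (g n)" for n
  proof -
    have "g n \<in> word_value ` lists X" using N g(1) unfolding monoid_span_def by blast
    then obtain ws\<^sub>0 where "ws\<^sub>0 \<in> lists X" "word_value ws\<^sub>0 = g n" by (elim imageE) simp
    then have "\<exists>k. \<exists>ws\<in>lists X. length ws = k \<and> word_value ws = g n" by blast
    then obtain ws where ws: "ws \<in> lists X" "length ws = len (g n)" "word_value ws = g n"
      unfolding len_def using LeastI_ex[of "\<lambda>k. \<exists>ws\<in>lists X. length ws = k \<and> word_value ws = g n"]
      by blast
    have "g n \<noteq> \<one>"
      using g(2)[of n] gcl[of "Suc n"] by (auto simp: strictly_below_def one_le_iff)
    then obtain x us where us: "ws = x # us" using ws(3) by (cases ws) auto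
    then have "len (word_value us) \<le> length us"
      unfolding len_def using ws(1) by (intro Least_le) auto
    then show ?thesis
      using us ws by (intro exI[of _ x] exI[of _ "word_value us"]) (auto simp: monoid_span_def)
  qed
  then obtain x u where xu: "\<And>n. x n \<in> X" "\<And>n. u n \<in> monoid_span X" "\<And>n. g n = x n \<otimes> u n"
    "\<And>n. len (u n) < len (g n)"
    by metis
  have "finite (range x)" using fin xu(1) by (auto intro: finite_subset)
  then obtain k where "infinite {n. x n = x k}"
    using pigeonhole_infinite[of "UNIV :: nat set" x] by auto
  then obtain e :: "nat \<Rightarrow> nat" where e: "strict_mono e" "\<And>n. x (e n) = x k"
    using infinite_enumerate[of "{n. x n = x k}"] by auto
  have "u (e n) \<prec> u (e (Suc n))" for n
  proof (rule ccontr)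
    assume "\<not> ?thesis"
    then have "u (e (Suc n)) \<preceq> u (e n)"
      using not_le_iff_below[OF tot] xu(2) cl by blast
    then have "g (e (Suc n)) \<preceq> g (e n)"
      unfolding xu(3) e(2) using xu(1,2) cl X by (intro mult_left_mono) auto
    then show False
      using g_mono[of "e n" "e (Suc n)"] e(1)
        not_le_iff_below[OF tot gcl[of "e n"] gcl[of "e (Suc n)"]]
      by (simp add: strict_mono_Suc_iff)
  qed
  then have "bad (\<lambda>n. u (e n))" using xu(2) by (simp add: bad_def)
  then have "u (e 0) \<in> N" by (auto simp: N_def)
  moreover have "g (e 0) \<preceq> u (e 0)"
    unfolding xu(3)[of "e 0"] using xu(1,2) cl X by (intro mult_le2) auto
  ultimately have "len (g (e 0)) \<le> len (u (e 0))"
    using g(1)[of "e 0"] by (simp add: shortest_def)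
  then show False using xu(4)[of "e 0"] by simp
qed

definition is_greatest :: "'a set \<Rightarrow> 'a \<Rightarrow> bool"
  where "is_greatest D m \<longleftrightarrow> m \<in> D \<and> (\<forall>b\<in>D. b \<preceq> m)"

lemma monoid_span_ex_greatest:
  assumes tot: "totally_ordered L" and fin: "finite X" and X: "X \<subseteq> carrier L"
    and D: "D \<subseteq> monoid_span X" "D \<noteq> {}"
  shows "\<exists>m. is_greatest D m"
proof (rule ccontr)
  assume not: "\<not> ?thesis"
  have "D \<subseteq> carrier L" using D monoid_span_subset[OF X] by blast
  then have "\<exists>b. b \<in> D \<and> a \<prec> b" if "a \<in> D" for a
    using that not not_le_iff_below[OF tot] unfolding is_greatest_def by blast
  then have "\<exists>f. \<forall>n. f n \<in> D \<and> f n \<prec> f (Suc n)"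
    using D(2) dependent_nat_choice[of "\<lambda>_ b. b \<in> D" "\<lambda>_ a b. a \<prec> b"] by blast
  then show False
    using monoid_span_ascending_chain_condition[OF tot fin X] D(1) by blast
qed

text \<open>A submonoid of a chain need not be closed under the residuals of the chain, but it has
  residuals of its own as soon as its nonempty subsets have greatest elements.\<close>

definition submonoid_chain :: "'a set \<Rightarrow> 'a rl"
  where "submonoid_chain M = L\<lparr>carrier := M,
    lres := (\<lambda>a d. SOME m. is_greatest {b \<in> M. a \<otimes> b \<preceq> d} m),
    rres := (\<lambda>d b. SOME m. is_greatest {a \<in> M. a \<otimes> b \<preceq> d} m)\<rparr>"

lemma submonoid_chain_simps [simp]:
  "carrier (submonoid_chain M) = M"
  "mult (submonoid_chain M) = (\<otimes>)"
  "one (submonoid_chain M) = \<one>"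
  "rl_meet (submonoid_chain M) = rl_meet L"
  "rl_join (submonoid_chain M) = rl_join L"
  "rl_le (submonoid_chain M) = rl_le L"
  by (simp_all add: submonoid_chain_def rl_le_def fun_eq_iff)

context
  fixes M
  assumes tot: "totally_ordered L" and M: "submonoid M L"
    and greatest: "\<And>D. \<lbrakk>D \<subseteq> M; D \<noteq> {}\<rbrakk> \<Longrightarrow> \<exists>m. is_greatest D m"
begin

lemma M_carrier: "x \<in> M \<Longrightarrow> x \<in> carrier L"
  using submonoid.subset[OF M] by blast

lemma submonoid_chain_residuals:
  assumes "a \<in> M" "d \<in> M"
  shows "is_greatest {b \<in> M. a \<otimes> b \<preceq> d} (lres (submonoid_chain M) a d)"
    "is_greatest {b \<in> M. b \<otimes> a \<preceq> d} (rres (submonoid_chain M) d a)"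
proof -
  have "d \<in> {b \<in> M. a \<otimes> b \<preceq> d}" "d \<in> {b \<in> M. b \<otimes> a \<preceq> d}"
    using assms M_carrier by (simp_all add: mult_le1 mult_le2)
  then have "\<exists>m. is_greatest {b \<in> M. a \<otimes> b \<preceq> d} m" "\<exists>m. is_greatest {b \<in> M. b \<otimes> a \<preceq> d} m"
    by (blast intro!: greatest)+
  then show "is_greatest {b \<in> M. a \<otimes> b \<preceq> d} (lres (submonoid_chain M) a d)"
    "is_greatest {b \<in> M. b \<otimes> a \<preceq> d} (rres (submonoid_chain M) d a)"
    unfolding submonoid_chain_def by (simp_all add: someI_ex)
qed

lemma residuated_lattice_submonoid_chain: "residuated_lattice (submonoid_chain M)"
proof -
  have meet: "x \<^bold>\<and> y \<in> M \<and> x \<^bold>\<or> y \<in> M" if xy: "x \<in> M" "y \<in> M" for x y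
  proof -
    have cl: "x \<in> carrier L" "y \<in> carrier L" using xy M_carrier by auto
    then consider "x \<preceq> y" | "y \<preceq> x" using tot by (auto simp: totally_ordered_def)
    then show ?thesis
    proof cases
      case 1
      then show ?thesis using xy cl le_iff_join[of x y] by (simp add: rl_le_def)
    next
      case 2
      then show ?thesis
        using xy cl le_iff_join[of y x] by (simp add: rl_le_def meet_comm[of x y] join_comm[of x y])
    qed
  qed
  note res = submonoid_chain_residuals[unfolded is_greatest_def]
  have l: "a \<otimes> b \<preceq> d \<longleftrightarrow> b \<preceq> lres (submonoid_chain M) a d"
    if abd: "a \<in> M" "b \<in> M" "d \<in> M" for a b d
  proof
    assume "a \<otimes> b \<preceq> d"
    then show "b \<preceq> lres (submonoid_chain M) a d" using res(1)[of a d] abd by blast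
  next
    let ?m = "lres (submonoid_chain M) a d"
    assume le: "b \<preceq> ?m"
    have m: "?m \<in> M" "a \<otimes> ?m \<preceq> d" using res(1)[of a d] abd by auto
    show "a \<otimes> b \<preceq> d"
      using le_trans[OF mult_left_mono[OF le] m(2)] abd m(1) M_carrier by simp
  qed
  have r: "a \<otimes> b \<preceq> d \<longleftrightarrow> a \<preceq> rres (submonoid_chain M) d b"
    if abd: "a \<in> M" "b \<in> M" "d \<in> M" for a b d
  proof
    assume "a \<otimes> b \<preceq> d"
    then show "a \<preceq> rres (submonoid_chain M) d b" using res(2)[of b d] abd by blast
  next
    let ?m = "rres (submonoid_chain M) d b"
    assume le: "a \<preceq> ?m"
    have m: "?m \<in> M" "?m \<otimes> b \<preceq> d" using res(2)[of b d] abd by auto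
    show "a \<otimes> b \<preceq> d"
      using le_trans[OF mult_right_mono[OF le] m(2)] abd m(1) M_carrier by simp
  qed
  show ?thesis
    by unfold_locales
      (use M_carrier meet res l r submonoid.m_closed[OF M] submonoid.one_closed[OF M] in
        \<open>auto simp: m_assoc meet_assoc meet_absorb join_assoc join_absorb
          intro: meet_comm join_comm\<close>)
qed

text \<open>This is why terms whose subterms all have values in \<open>M\<close> are evaluated in \<open>M\<close> as in \<open>L\<close>.\<close>

lemma submonoid_chain_residuals_eq:
  assumes "a \<in> M" "d \<in> M"
  shows "lres L a d \<in> M \<Longrightarrow> lres (submonoid_chain M) a d = lres L a d"
    "rres L d a \<in> M \<Longrightarrow> rres (submonoid_chain M) d a = rres L d a"
proof -
  note res = submonoid_chain_residuals[OF assms, unfolded is_greatest_def]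
  have cl: "a \<in> carrier L" "d \<in> carrier L" "lres (submonoid_chain M) a d \<in> carrier L"
    "rres (submonoid_chain M) d a \<in> carrier L"
    using assms res M_carrier by auto
  show "lres (submonoid_chain M) a d = lres L a d" if "lres L a d \<in> M"
    using that res(1) cl lres_le[of a d] by (intro le_antisym) (auto simp flip: residuation_left)
  show "rres (submonoid_chain M) d a = rres L d a" if "rres L d a \<in> M"
    using that res(2) cl rres_le[of a d] by (intro le_antisym) (auto simp flip: residuation_right)
qed

end

end

section \<open>Generation by finitely generated chains\<close>

primrec subterms :: "'v rl_term \<Rightarrow> 'v rl_term set"
  where
    "subterms (Var x) = {Var x}"
  | "subterms Unit = {Unit}"
  | "subterms (Times s t) = insert (Times s t) (subterms s \<union> subterms t)"
  | "subterms (Meet s t) = insert (Meet s t) (subterms s \<union> subterms t)"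
  | "subterms (Join s t) = insert (Join s t) (subterms s \<union> subterms t)"
  | "subterms (LDiv s t) = insert (LDiv s t) (subterms s \<union> subterms t)"
  | "subterms (RDiv s t) = insert (RDiv s t) (subterms s \<union> subterms t)"

lemma finite_subterms: "finite (subterms t)"
  by (induction t) simp_all

lemma self_in_subterms: "t \<in> subterms t"
  by (cases t) simp_all

lemma eval_term_cong_ops:
  assumes "mult A = mult B" "one A = one B"
  shows "eval_term A v t = eval_term B v t"
  using assms by (induction t) simp_all

lemma finitely_generated_monoid_image:
  fixes A :: "'a rl" and B :: "'b rl"
  assumes h: "h \<in> rl_hom A B" and sur: "h ` carrier A = carrier B" and A: "closed_algebra A"
    and fg: "finitely_generated_monoid A"
  shows "finitely_generated_monoid B"
proof -
  obtain X where X: "finite X" "X \<subseteq> carrier A"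
    and gen: "\<forall>H. submonoid H A \<and> X \<subseteq> H \<longrightarrow> H = carrier A"
    using fg unfolding finitely_generated_monoid_def by blast
  have "H = carrier B" if H: "submonoid H B" "h ` X \<subseteq> H" for H
  proof -
    let ?G = "{a \<in> carrier A. h a \<in> H}"
    have "submonoid ?G A"
    proof
      show "?G \<subseteq> carrier A" by blast
      show "\<one>\<^bsub>A\<^esub> \<in> ?G"
        using h A submonoid.one_closed[OF H(1)] by (simp add: rl_hom_def rl_subuniverse_def)
      fix x y assume "x \<in> ?G" "y \<in> ?G"
      then show "x \<otimes>\<^bsub>A\<^esub> y \<in> ?G"
        using h A submonoid.m_closed[OF H(1)]
        by (simp add: rl_hom_def hom_def rl_subuniverse_def)
    qed
    moreover have "X \<subseteq> ?G" using X H(2) by blast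
    ultimately have "?G = carrier A" using gen by blast
    then have "h ` carrier A \<subseteq> H" by blast
    then have "carrier B \<subseteq> H" using sur by simp
    then show ?thesis using submonoid.subset[OF H(1)] by blast
  qed
  moreover have "finite (h ` X)" "h ` X \<subseteq> carrier B" using X sur by auto
  ultimately show ?thesis unfolding finitely_generated_monoid_def by blast
qed

lemma totally_ordered_imp_semilinear:
  fixes A :: "'a rl"
  assumes A: "residuated_lattice A" "totally_ordered A"
  shows "semilinear A"
proof (rule semilinearI[OF residuated_lattice.closed_algebra[OF A(1)]])
  fix a b assume "a \<in> carrier A" "b \<in> carrier A" "a \<noteq> b"
  moreover have "id \<in> rl_hom A A" by (simp add: rl_hom_def hom_def)
  ultimately show "\<exists>(B :: 'a rl) h. residuated_lattice B \<and> totally_ordered B \<and> h \<in> rl_hom A B \<and>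
      h ` carrier A = carrier B \<and> h a \<noteq> h b"
    using A by (intro exI[of _ A] exI[of _ id]) simp
qed

text \<open>An identity that fails in a chain \<open>C\<close> already fails in a finitely generated one: the submonoid
  generated by the values of all subterms is a chain with residuals of its own, and
  evaluating the two terms in it gives the same values as in \<open>C\<close>. It inherits the monoid identities
  and cancellativity, and being countable it has a copy in any infinite type.\<close>

lemma identity_fails_in_finitely_generated_chain:
  fixes C :: "'a rl" and p :: "'v rl_term \<times> 'v rl_term" and E :: "(monoid_term \<times> monoid_term) set"
  assumes inf: "infinite (UNIV :: 'k set)"
    and C: "residuated_lattice C" "totally_ordered C" "integral C" "cancellative C"
      "\<forall>q\<in>E. satisfies C q"
    and fails: "\<not> models C p"
  shows "\<exists>B :: 'k rl. B \<in> monoid_variety E \<and> totally_ordered B \<and> finitely_generated_monoid B \<and>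
    \<not> models B p"
proof -
  interpret C: integral_residuated_lattice C
    using C by (simp add: integral_residuated_lattice_def integral_residuated_lattice_axioms_def)
  obtain v where v: "range v \<subseteq> carrier C" "rl_eval C v (fst p) \<noteq> rl_eval C v (snd p)"
    using fails by (auto simp: models_def)
  define X where "X = rl_eval C v ` (subterms (fst p) \<union> subterms (snd p))"
  define M where "M = C.monoid_span X"
  define D where "D = C.submonoid_chain M"
  have X: "finite X" "X \<subseteq> carrier C"
    using rl_eval_in_subuniverse[OF C.closed_algebra v(1)] by (auto simp: X_def finite_subterms)
  have M: "submonoid M C" "M \<subseteq> carrier C" "X \<subseteq> M"
    unfolding M_def
    by (rule C.submonoid_monoid_span[OF X(2)] C.monoid_span_subset[OF X(2)]
        C.subset_monoid_span[OF X(2)])+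
  have greatest: "\<exists>m. C.is_greatest S m" if "S \<subseteq> M" "S \<noteq> {}" for S
    using C.monoid_span_ex_greatest[OF C(2) X] that by (simp add: M_def)
  have D: "residuated_lattice D"
    unfolding D_def by (rule C.residuated_lattice_submonoid_chain[OF C(2) M(1) greatest])
  note clD = residuated_lattice.closed_algebra[OF D]
  have D_simps: "carrier D = M" "mult D = mult C" "one D = one C" "rl_le D = rl_le C"
    by (simp_all add: D_def)
  have D_tot: "totally_ordered D"
    using C(2) M(2) by (auto simp: totally_ordered_def D_simps)
  have D_int: "integral D"
    using C(3) M(2) by (auto simp: integral_def D_def)
  have D_canc: "cancellative D"
    using C(4) M(2) unfolding cancellative_def D_simps by blast
  have D_E: "satisfies D q" if "q \<in> E" for q
    using C(5) that M(2) eval_term_cong_ops[OF D_simps(2,3)]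
    unfolding satisfies_def D_simps by (metis subset_trans)
  have D_fg: "finitely_generated_monoid D"
    unfolding finitely_generated_monoid_def
  proof (intro exI[of _ X] conjI allI impI)
    fix H assume "submonoid H D \<and> X \<subseteq> H"
    then have H: "submonoid H D" "X \<subseteq> H" by auto
    have "M \<subseteq> H"
      unfolding M_def
      by (rule C.monoid_span_minimal)
        (use H submonoid.one_closed[OF H(1)] submonoid.m_closed[OF H(1)] in \<open>auto simp: D_simps\<close>)
    then show "H = carrier D"
      using submonoid.subset[OF H(1)] by (auto simp: D_simps)
  qed (use X M in \<open>auto simp: D_simps\<close>)
  \<comment> \<open>Variables outside the two terms may take values outside \<open>M\<close>; they are sent to the unit.\<close>
  define w where "w x = (if v x \<in> M then v x else \<one>\<^bsub>C\<^esub>)" for x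
  have w: "range w \<subseteq> carrier D"
    using submonoid.one_closed[OF M(1)] by (auto simp: w_def D_simps)
  have eval: "rl_eval D w t = rl_eval C v t" if "rl_eval C v ` subterms t \<subseteq> M" for t
    using that
  proof (induction t)
    case (Var x)
    then show ?case by (simp add: w_def)
  next
    case (LDiv s t)
    have "rl_eval C v ` subterms s \<subseteq> M" "rl_eval C v ` subterms t \<subseteq> M"
      "rl_eval C v s \<in> M" "rl_eval C v t \<in> M" "rl_eval C v (LDiv s t) \<in> M"
      using LDiv.prems self_in_subterms[of s] self_in_subterms[of t] by auto
    then show ?case
      using LDiv.IH C.submonoid_chain_residuals_eq(1)[OF C(2) M(1) greatest] by (simp add: D_def)
  next
    case (RDiv s t)
    have "rl_eval C v ` subterms s \<subseteq> M" "rl_eval C v ` subterms t \<subseteq> M"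
      "rl_eval C v s \<in> M" "rl_eval C v t \<in> M" "rl_eval C v (RDiv s t) \<in> M"
      using RDiv.prems self_in_subterms[of s] self_in_subterms[of t] by auto
    then show ?case
      using RDiv.IH C.submonoid_chain_residuals_eq(2)[OF C(2) M(1) greatest] by (simp add: D_def)
  qed (simp_all add: D_def image_Un)
  have "rl_eval D w (fst p) \<noteq> rl_eval D w (snd p)"
    using v(2) M(3) by (simp add: eval X_def image_Un)
  then have D_fails: "\<not> models D p" using w by (auto simp: models_def)
  obtain c :: "nat \<Rightarrow> 'k" where c: "inj c"
    using infinite_countable_subset[OF inf] by blast
  define f where "f = c \<circ> to_nat_on M"
  define B where "B = rl_image f D"
  have "countable M" unfolding M_def by (rule C.countable_monoid_span[OF X(1)])
  then have inj: "inj_on f (carrier D)"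
    unfolding f_def D_simps by (intro comp_inj_on inj_on_to_nat_on inj_on_subset[OF c]) auto
  have f: "f \<in> rl_hom D B"
    unfolding B_def by (rule rl_image_hom) (use inj in \<open>simp add: inj_on_eq_iff\<close>)
  have sur: "f ` carrier D = carrier B" by (simp add: B_def)
  note sat = satisfies_identities_of_image[OF f clD sur]
  have B: "residuated_lattice B" "integral B" "cancellative B" "\<forall>q\<in>E. satisfies B q"
    using residuated_lattice_inherited[OF sat] integral_inherited[OF sat]
      cancellative_inherited[OF sat] satisfies_inherited[OF sat] D D_int D_canc D_E by simp_all
  have tot: "totally_ordered B"
    by (rule totally_ordered_image[OF f sur])
      (use D_tot[unfolded totally_ordered_def rl_le_def] in metis)
  have "B \<in> monoid_variety E"
    using B tot totally_ordered_imp_semilinear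
    by (simp add: monoid_variety_def semilinear_canc_int_def)
  moreover have "\<not> models B p"
    using models_embedding[OF f clD inj] D_fails by blast
  ultimately show ?thesis
    using tot finitely_generated_monoid_image[OF f sur clD D_fg] by blast
qed

lemma subdirect_projection:
  assumes "subdirect_product S I F" "h \<in> rl_hom A (rl_product I F\<lparr>carrier := S\<rparr>)"
    "bij_betw h (carrier A) S" "i \<in> I"
  shows "(\<lambda>x. h x i) \<in> rl_hom A (F i)" "(\<lambda>x. h x i) ` carrier A = carrier (F i)"
proof -
  have "(\<lambda>x. x i) ` S = carrier (F i)" using assms(1,4) by (simp add: subdirect_product_def)
  then show sur: "(\<lambda>x. h x i) ` carrier A = carrier (F i)"
    using assms(3) by (auto simp: bij_betw_def image_image)
  have "h x i \<in> carrier (F i)" if "x \<in> carrier A" for x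
    using sur that by blast
  then show "(\<lambda>x. h x i) \<in> rl_hom A (F i)"
    using assms(2,4) by (simp add: rl_hom_def hom_def rl_product_def)
qed

theorem theorem7p3:
  fixes E :: "(monoid_term \<times> monoid_term) set"
  assumes "infinite (UNIV :: 'k set)"
  shows "(monoid_variety E :: 'a rl set) =
    generated_variety
      {B :: 'k rl. B \<in> monoid_variety E \<and> totally_ordered B \<and> finitely_generated_monoid B}"
proof (rule equalityI; rule subsetI)
  let ?K = "{B :: 'k rl. B \<in> monoid_variety E \<and> totally_ordered B \<and> finitely_generated_monoid B}"
  have K: "residuated_lattice B" "cancellative B" "integral B" "\<And>p. p \<in> E \<Longrightarrow> satisfies B p"
    "totally_ordered B" if "B \<in> ?K" for B
    using that by (auto simp: monoid_variety_def semilinear_canc_int_def)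
  note clK = residuated_lattice.closed_algebra[OF K(1)]
  fix A :: "'a rl"
  {
    assume A: "A \<in> monoid_variety E"
    then have A_rl: "residuated_lattice A" and A': "cancellative A" "integral A"
      "\<And>p. p \<in> E \<Longrightarrow> satisfies A p" and "semilinear A"
      by (auto simp: monoid_variety_def semilinear_canc_int_def)
    then obtain I :: "('a \<times> 'a) set" and F :: "'a \<times> 'a \<Rightarrow> 'a rl" and S h
      where F: "\<forall>i\<in>I. residuated_lattice (F i) \<and> totally_ordered (F i)"
        and S: "subdirect_product S I F"
        and h: "h \<in> rl_hom A (rl_product I F\<lparr>carrier := S\<rparr>)" "bij_betw h (carrier A) S"
      unfolding semilinear_def by blast
    note clA = residuated_lattice.closed_algebra[OF A_rl]
    have "satisfies_identities_of A (F ` I)"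
    proof (rule satisfies_identities_of_subproduct[OF _ clA _ h(1)])
      show "closed_algebra (F i)" if "i \<in> I" for i
        using F that by (simp add: residuated_lattice.closed_algebra)
      show "S \<subseteq> carrier (rl_product I F)"
        using S by (simp add: subdirect_product_def rl_subuniverse_def)
      show "inj_on h (carrier A)" using h(2) by (rule bij_betw_imp_inj_on)
    qed
    moreover have "models (F i) p"
      if i: "i \<in> I" and p: "\<forall>B\<in>?K. models B p" for i and p :: "'a rl_term \<times> 'a rl_term"
    proof (rule ccontr)
      assume fails: "\<not> models (F i) p"
      have Fi: "residuated_lattice (F i)" "totally_ordered (F i)" using F i by auto
      note proj = subdirect_projection[OF S h i]
      note sat = satisfies_identities_of_image[OF proj(1) clA proj(2)]
      have "integral (F i)" "cancellative (F i)" "\<forall>q\<in>E. satisfies (F i) q"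
        using integral_inherited[OF sat] cancellative_inherited[OF sat] satisfies_inherited[OF sat]
          A_rl A' by simp_all
      from identity_fails_in_finitely_generated_chain[OF assms Fi this fails] p show False by blast
    qed
    ultimately have "satisfies_identities_of A ?K"
      by (simp add: satisfies_identities_of_def)
    then show "A \<in> generated_variety ?K"
      by (rule identities_imp_generated_variety) (rule clK)
  next
    assume "A \<in> generated_variety ?K"
    then have sat: "satisfies_identities_of A ?K"
      by (rule generated_variety_satisfies_identities) (rule clK)
    have A: "residuated_lattice A" "integral A" "cancellative A"
      by (rule residuated_lattice_inherited[OF sat] integral_inherited[OF sat]
          cancellative_inherited[OF sat]; erule K)+
    have A_E: "\<forall>p\<in>E. satisfies A p"
      by (intro ballI satisfies_inherited[OF sat] K(4))
    have "prelinear B" if B: "B \<in> ?K" for B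
      using K(1,3,5)[OF B]
      by (simp add: integral_residuated_lattice.totally_ordered_imp_prelinear
          integral_residuated_lattice_def integral_residuated_lattice_axioms_def)
    then have "prelinear A" by (rule prelinear_inherited[OF sat])
    then have "semilinear A"
      using A by (simp add: integral_residuated_lattice.prelinear_imp_semilinear
          integral_residuated_lattice_def integral_residuated_lattice_axioms_def)
    then show "A \<in> monoid_variety E"
      using A A_E by (simp add: monoid_variety_def semilinear_canc_int_def)
  }
qed

end
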